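(* Let $p$ be an odd prime, $n\ge 1$ and $k\ge 0$. The set of all elements $$\Big[u_1^{\epsilon_1}v_1^{[(p-1)(i_1+b(I))-\epsilon_1]}\cdots u_n^{\epsilon_n}v_n^{[p^{n-1}(p-1)(i_1+\cdots+i_n+b(I))-p^{n-1}\epsilon_n]}\Big]$$ (the $s$-th factor being $u_s^{\epsilon_s}v_s^{[p^{s-1}(p-1)(i_1+\cdots+i_s+b(I))-p^{s-1}\epsilon_s]}$), for $I=(\epsilon_1,i_1,\dots,\epsilon_n,i_n)$ with $i_1\in\mathbb{Z}$, $i_s\ge 0$ for $2\le s\le n$, $\epsilon_s\in\{0,1\}$ and $2i_1+b(I)\ge k$, provides an additive basis for $\mathscr{B}_k[n]^*$, the dual of $\mathscr{B}_k[n]$.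
   Context: $\mathbb{V}_n=(\mathbb{Z}/p)^n$; $H^*B\mathbb{V}_n=E(e_1,\dots,e_n)\otimes\mathbb{F}_p[x_1,\dots,x_n]$ (mod $p$ cohomology), $|e_i|=1$, $x_i=\beta e_i$, $|x_i|=2$. $H_*B\mathbb{V}_n$ is the tensor product of the exterior algebra on $u_1,\dots,u_n$ ($u_i$ dual to $e_i$) and the divided power algebra on $v_1,\dots,v_n$ ($v_i$ dual to $x_i$); $v_i^{[t]}$ is the $t$-th divided power. Put $[r_1,\dots,r_n]=\det(x_i^{p^{r_j}})$, $L_{n,i}=[0,\dots,\hat i,\dots,n]$ (omit $i$), $L_n=L_{n,n}$, $q_{n,i}=L_{n,i}/L_n$ ($0\le i\le n-1$). For $0\le s_1<\cdots<s_k\le n-1$ let $M_{n;s_1,\dots,s_k}=\frac1{k!}\det$ of the $n\times n$ matrix whose first $k$ rows are all $(e_1,\dots,e_n)$ and whose remaining rows are $(x_1^{p^r},\dots,x_n^{p^r})$ for $r\in\{0,\dots,n-1\}\setminus\{s_1,\dots,s_k\}$ in increasing order (determinant expanded as $\sum_\pi\mathrm{sgn}(\pi)a_{1\pi(1)}\cdots a_{n\pi(n)}$), and $R_{n;s_1,\dots,s_k}=M_{n;s_1,\dots,s_k}L_n^{p-2}$. For $I=(\epsilon_1,i_1,\dots,\epsilon_n,i_n)$ put $b(I)=\sum_s\epsilon_s$ and $q^I=R_{n;0}^{\epsilon_1}q_{n,0}^{i_1}\cdots R_{n;n-1}^{\epsilon_n}q_{n,n-1}^{i_n}$. If $i_1<0$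 this is interpreted in the localization inverting $q_{n,0}$, using $R_{n;s_1}\cdots R_{n;s_k}=(-1)^{k(k-1)/2}R_{n;s_1,\dots,s_k}q_{n,0}^{k-1}$; for the indices considered it lies in $H^*B\mathbb{V}_n$. $\mathscr{B}_k[n]\subset H^*B\mathbb{V}_n$ is the span of the $q^I$ with $i_1\in\mathbb{Z}$, $i_s\ge 0$ ($2\le s\le n$), $\epsilon_s\in\{0,1\}$, $2i_1+b(I)\ge k$ (it is a subalgebra). $\mathscr{B}_k[n]^*$ is its graded dual, a quotient of $H_*B\mathbb{V}_n$ (dual of the inclusion), and $[z]$ is the image of $z\in H_*B\mathbb{V}_n$ in it. *)

theory Defs
  imports
    "Berlekamp_Zassenhaus.Finite_Field"
    "Jordan_Normal_Form.Determinant"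
    "HOL-Library.Poly_Mapping"
    "HOL-Library.FSet"
    "HOL-Library.FuncSet"
    "HOL-Library.Function_Algebras"
    "HOL-Computational_Algebra.Fraction_Field"
    "HOL-Combinatorics.Permutations"
begin

section \<open>Bilinear extension of a product given on basis elements\<close>

text \<open>
  Finitely supported functions on \<open>'m\<close> are multiplied by bilinearly extending the rule
  that the product of the basis elements \<open>a\<close> and \<open>b\<close> is \<open>c a b\<close> times the basis element \<open>opr a b\<close>.
\<close>

definition conv ::
  "('m \<Rightarrow> 'm \<Rightarrow> 'm) \<Rightarrow> ('m \<Rightarrow> 'm \<Rightarrow> 'a) \<Rightarrow> ('m \<Rightarrow>\<^sub>0 'a) \<Rightarrow> ('m \<Rightarrow>\<^sub>0 'a) \<Rightarrow> ('m \<Rightarrow>\<^sub>0 'a::comm_ring_1)"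
  where "conv opr c f g =
    (\<Sum>a\<in>Poly_Mapping.keys f. \<Sum>b\<in>Poly_Mapping.keys g.
       Poly_Mapping.single (opr a b)
         (c a b * Poly_Mapping.lookup f a * Poly_Mapping.lookup g b))"

lemma conv_superset:
  assumes "finite F" "finite G" "Poly_Mapping.keys f \<subseteq> F" "Poly_Mapping.keys g \<subseteq> G"
  shows "conv opr c f g = (\<Sum>a\<in>F. \<Sum>b\<in>G.
       Poly_Mapping.single (opr a b) (c a b * Poly_Mapping.lookup f a * Poly_Mapping.lookup g b))"
proof -
  have "(\<Sum>a\<in>F. \<Sum>b\<in>G.
       Poly_Mapping.single (opr a b) (c a b * Poly_Mapping.lookup f a * Poly_Mapping.lookup g b))
    = (\<Sum>a\<in>Poly_Mapping.keys f. \<Sum>b\<in>G.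
       Poly_Mapping.single (opr a b) (c a b * Poly_Mapping.lookup f a * Poly_Mapping.lookup g b))"
    by (rule sum.mono_neutral_right) (use assms in \<open>auto simp: in_keys_iff\<close>)
  also have "\<dots> = conv opr c f g"
    unfolding conv_def
    by (intro sum.cong refl sum.mono_neutral_right) (use assms in \<open>auto simp: in_keys_iff\<close>)
  finally show ?thesis by simp
qed

lemma conv_add_left: "conv opr c (f + f') g = conv opr c f g + conv opr c f' g"
proof -
  let ?F = "Poly_Mapping.keys f \<union> Poly_Mapping.keys f'" and ?G = "Poly_Mapping.keys g"
  have "Poly_Mapping.keys (f + f') \<subseteq> ?F" by (rule keys_add)
  then show ?thesis
    by (simp add: conv_superset[of ?F ?G] lookup_add ring_distribs single_add sum.distrib)
qed

lemma conv_add_right: "conv opr c f (g + g') = conv opr c f g + conv opr c f g'"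
proof -
  let ?F = "Poly_Mapping.keys f" and ?G = "Poly_Mapping.keys g \<union> Poly_Mapping.keys g'"
  have "Poly_Mapping.keys (g + g') \<subseteq> ?G" by (rule keys_add)
  then show ?thesis
    by (simp add: conv_superset[of ?F ?G] lookup_add ring_distribs single_add sum.distrib)
qed

lemma conv_zero [simp]: "conv opr c 0 g = 0" "conv opr c f 0 = 0"
  by (simp_all add: conv_def)

lemma conv_single:
  "conv opr c (Poly_Mapping.single a u) (Poly_Mapping.single b v)
     = Poly_Mapping.single (opr a b) (c a b * u * v)"
  by (subst conv_superset[of "{a}" "{b}"]) auto

lemma poly_mapping_induct_single:
  fixes f :: "'m \<Rightarrow>\<^sub>0 'a::comm_monoid_add"
  assumes "P 0" "\<And>a u. P (Poly_Mapping.single a u)" "\<And>f g. P f \<Longrightarrow> P g \<Longrightarrow> P (f + g)"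
  shows "P f"
proof -
  have f: "f = (\<Sum>a\<in>Poly_Mapping.keys f. Poly_Mapping.single a (Poly_Mapping.lookup f a))"
    by (rule poly_mapping_eqI)
      (auto simp: lookup_sum lookup_single when_def in_keys_iff sum.delta')
  have "finite A \<Longrightarrow> P (\<Sum>a\<in>A. Poly_Mapping.single a (Poly_Mapping.lookup f a))" for A
    by (induction A rule: finite_induct) (use assms in auto)
  then show ?thesis using f by (metis finite_keys)
qed

lemma conv_assoc:
  assumes "\<And>a b d. opr (opr a b) d = opr a (opr b d)"
    and "\<And>a b d. c a b * c (opr a b) d = c a (opr b d) * c b d"
  shows "conv opr c (conv opr c f g) h = conv opr c f (conv opr c g h)"
proof (induction f rule: poly_mapping_induct_single)
  case (2 a u)
  show ?case
  proof (induction g rule: poly_mapping_induct_single)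
    case (2 b v)
    show ?case
    proof (induction h rule: poly_mapping_induct_single)
      case (2 d w)
      have "c (opr a b) d * (c a b * u * v) * w = c a (opr b d) * u * (c b d * v * w)"
        using assms(2)[of a b d] by (metis (no_types, lifting) mult.assoc mult.commute)
      then show ?case by (simp add: conv_single assms(1))
    qed (simp_all add: conv_add_right)
  qed (simp_all add: conv_add_left conv_add_right)
qed (simp_all add: conv_add_left)

lemma conv_commute:
  assumes "\<And>a b. opr a b = opr b a" and "\<And>a b. c a b = c b a"
  shows "conv opr c f g = conv opr c g f"
proof -
  have "conv opr c f g = (\<Sum>b\<in>Poly_Mapping.keys g. \<Sum>a\<in>Poly_Mapping.keys f.
       Poly_Mapping.single (opr a b) (c a b * Poly_Mapping.lookup f a * Poly_Mapping.lookup g b))"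
    unfolding conv_def by (rule sum.swap)
  also have "\<dots> = conv opr c g f"
    unfolding conv_def
    by (intro sum.cong refl arg_cong2[of _ _ _ _ Poly_Mapping.single])
      (simp_all add: assms ac_simps)
  finally show ?thesis .
qed

lemma conv_unit_left:
  assumes "\<And>a. opr e a = a" "\<And>a. c e a = 1"
  shows "conv opr c (Poly_Mapping.single e 1) f = f"
  by (induction f rule: poly_mapping_induct_single)
    (simp_all add: conv_add_right conv_single assms)

lemma conv_unit_right:
  assumes "\<And>a. opr a e = a" "\<And>a. c a e = 1"
  shows "conv opr c f (Poly_Mapping.single e 1) = f"
  by (induction f rule: poly_mapping_induct_single)
    (simp_all add: conv_add_left conv_single assms)

section \<open>Exterior algebras\<close>

text \<open>
  \<open>'a ext\<close> is the exterior algebra over \<open>'a\<close> on generators indexed by \<open>nat\<close>. The basis element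
  of a finite set is the product of its generators in increasing order; coefficients are central.
\<close>

typedef (overloaded) 'a ext = "UNIV :: (nat fset \<Rightarrow>\<^sub>0 'a::zero) set"
  morphisms ext_coeffs Ext ..

declare Ext_inverse [OF UNIV_I, simp] ext_coeffs_inverse [simp] Ext_inject [OF UNIV_I UNIV_I, simp]

definition shuffle_sign :: "nat fset \<Rightarrow> nat fset \<Rightarrow> 'a::comm_ring_1" where
  "shuffle_sign A B =
     (if A |\<inter>| B = {||} then (-1) ^ card {(a, b). a |\<in>| A \<and> b |\<in>| B \<and> b < a} else 0)"

lemma finite_inversions: "finite {(a, b). a |\<in>| A \<and> b |\<in>| B \<and> b < (a::nat)}"
  by (rule finite_subset[of _ "fset A \<times> fset B"]) auto

lemma card_inversions_union_left:
  assumes "A |\<inter>| B = {||}"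
  shows "card {(a, b). a |\<in>| A |\<union>| B \<and> b |\<in>| D \<and> b < (a::nat)}
    = card {(a, b). a |\<in>| A \<and> b |\<in>| D \<and> b < a} + card {(a, b). a |\<in>| B \<and> b |\<in>| D \<and> b < a}"
proof -
  have "{(a, b). a |\<in>| A |\<union>| B \<and> b |\<in>| D \<and> b < a}
    = {(a, b). a |\<in>| A \<and> b |\<in>| D \<and> b < a} \<union> {(a, b). a |\<in>| B \<and> b |\<in>| D \<and> b < a}"
    by auto
  then show ?thesis
    using assms by (simp only:) (rule card_Un_disjoint, auto simp: finite_inversions)
qed

lemma card_inversions_union_right:
  assumes "B |\<inter>| D = {||}"
  shows "card {(a, b). a |\<in>| A \<and> b |\<in>| B |\<union>| D \<and> b < (a::nat)}
    = card {(a, b). a |\<in>| A \<and> b |\<in>| B \<and> b < a} + card {(a, b). a |\<in>| A \<and> b |\<in>| D \<and> b < a}"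
proof -
  have "{(a, b). a |\<in>| A \<and> b |\<in>| B |\<union>| D \<and> b < a}
    = {(a, b). a |\<in>| A \<and> b |\<in>| B \<and> b < a} \<union> {(a, b). a |\<in>| A \<and> b |\<in>| D \<and> b < a}"
    by auto
  then show ?thesis
    using assms by (simp only:) (rule card_Un_disjoint, auto simp: finite_inversions)
qed

lemma shuffle_sign_cocycle:
  "shuffle_sign A B * shuffle_sign (A |\<union>| B) D = shuffle_sign A (B |\<union>| D) * (shuffle_sign B D :: 'a::comm_ring_1)"
proof (cases "A |\<inter>| B = {||} \<and> A |\<inter>| D = {||} \<and> B |\<inter>| D = {||}")
  case True
  then have "(A |\<union>| B) |\<inter>| D = {||}" "A |\<inter>| (B |\<union>| D) = {||}" by auto
  with True show ?thesis
    using card_inversions_union_left[of A B D] card_inversions_union_right[of B D A]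
    by (simp add: shuffle_sign_def power_add)
next
  case False
  have "(A |\<union>| B) |\<inter>| D = {||} \<longleftrightarrow> A |\<inter>| D = {||} \<and> B |\<inter>| D = {||}"
    "A |\<inter>| (B |\<union>| D) = {||} \<longleftrightarrow> A |\<inter>| B = {||} \<and> A |\<inter>| D = {||}" by auto
  with False show ?thesis by (auto simp: shuffle_sign_def)
qed

instantiation ext :: (comm_ring_1) ring_1
begin

definition "0 = Ext 0"
definition "1 = Ext (Poly_Mapping.single {||} 1)"
definition "x + y = Ext (ext_coeffs x + ext_coeffs y)"
definition "- x = Ext (- ext_coeffs x)"
definition "x - y = Ext (ext_coeffs x - ext_coeffs y)"
definition "x * y = Ext (conv (|\<union>|) shuffle_sign (ext_coeffs x) (ext_coeffs y))"

instance
proof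
  fix a b c :: "'a ext"
  show "a * b * c = a * (b * c)"
    by (simp add: times_ext_def conv_assoc shuffle_sign_cocycle funion_assoc)
  show "1 * a = a" "a * 1 = a"
    by (simp_all add: times_ext_def one_ext_def conv_unit_left conv_unit_right shuffle_sign_def)
  show "(0::'a ext) \<noteq> 1"
    by (simp add: zero_ext_def one_ext_def)
      (metis lookup_single_eq lookup_zero zero_neq_one)
qed (simp_all add: plus_ext_def zero_ext_def uminus_ext_def minus_ext_def times_ext_def
    conv_add_left conv_add_right add_ac)

end

definition ext_gen :: "nat \<Rightarrow> 'a::comm_ring_1 ext" where
  "ext_gen i = Ext (Poly_Mapping.single {|i|} 1)"

definition ext_const :: "'a::comm_ring_1 \<Rightarrow> 'a ext" where
  "ext_const c = Ext (Poly_Mapping.single {||} c)"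

definition ext_coeff :: "'a::comm_ring_1 ext \<Rightarrow> nat fset \<Rightarrow> 'a" where
  "ext_coeff y A = Poly_Mapping.lookup (ext_coeffs y) A"

definition map_coeffs :: "('a::comm_ring_1 \<Rightarrow> 'b::comm_ring_1) \<Rightarrow> 'a ext \<Rightarrow> 'b ext" where
  "map_coeffs f y = Ext (Poly_Mapping.map f (ext_coeffs y))"

section \<open>Divided power algebras\<close>

text \<open>
  \<open>'a dpow\<close> is the divided power algebra over \<open>'a\<close> on generators indexed by \<open>nat\<close>; the basis
  element of \<open>t\<close> is the product of the divided powers \<open>v\<^sub>i\<^sup>[\<^sup>t\<^sup>i\<^sup>]\<close>.
\<close>

typedef (overloaded) 'a dpow = "UNIV :: ((nat \<Rightarrow>\<^sub>0 nat) \<Rightarrow>\<^sub>0 'a::zero) set"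
  morphisms dpow_coeffs DPow ..

declare DPow_inverse [OF UNIV_I, simp] dpow_coeffs_inverse [simp] DPow_inject [OF UNIV_I UNIV_I, simp]

definition multi_choose :: "(nat \<Rightarrow>\<^sub>0 nat) \<Rightarrow> (nat \<Rightarrow>\<^sub>0 nat) \<Rightarrow> nat" where
  "multi_choose s t = (\<Prod>i\<in>Poly_Mapping.keys (s + t).
     (Poly_Mapping.lookup s i + Poly_Mapping.lookup t i) choose Poly_Mapping.lookup s i)"

lemma multi_choose_superset:
  assumes "finite K" "Poly_Mapping.keys s \<subseteq> K" "Poly_Mapping.keys t \<subseteq> K"
  shows "multi_choose s t = (\<Prod>i\<in>K.
     (Poly_Mapping.lookup s i + Poly_Mapping.lookup t i) choose Poly_Mapping.lookup s i)"
  unfolding multi_choose_def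
proof (rule prod.mono_neutral_left)
  show "Poly_Mapping.keys (s + t) \<subseteq> K" using keys_add[of s t] assms by blast
qed (use assms in \<open>auto simp: in_keys_iff lookup_add\<close>)

lemma multi_choose_commute: "multi_choose s t = multi_choose t s"
proof -
  have "((a + b) choose a) = ((b + a) choose b)" for a b :: nat
    using binomial_symmetric[of a "a + b"] by (simp add: add.commute)
  then show ?thesis
    unfolding multi_choose_def by (intro prod.cong) (simp_all add: add.commute)
qed

lemma multi_choose_cocycle:
  "multi_choose s t * multi_choose (s + t) r = multi_choose s (t + r) * multi_choose t r"
proof -
  let ?K = "Poly_Mapping.keys s \<union> Poly_Mapping.keys t \<union> Poly_Mapping.keys r"
  have K: "Poly_Mapping.keys (s + t) \<subseteq> ?K" "Poly_Mapping.keys (t + r) \<subseteq> ?K"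
    using keys_add[of s t] keys_add[of t r] by blast+
  have "((a + b) choose a) * ((a + b + d) choose (a + b))
      = ((a + (b + d)) choose a) * ((b + d) choose b)" for a b d :: nat
    using choose_mult_lemma[of b d a] by (simp add: ac_simps)
  then show ?thesis
    using K by (simp add: multi_choose_superset[of ?K] le_supI1 lookup_add prod.distrib[symmetric])
qed

instantiation dpow :: (comm_ring_1) comm_ring_1
begin

definition "0 = DPow 0"
definition "1 = DPow (Poly_Mapping.single 0 1)"
definition "x + y = DPow (dpow_coeffs x + dpow_coeffs y)"
definition "- x = DPow (- dpow_coeffs x)"
definition "x - y = DPow (dpow_coeffs x - dpow_coeffs y)"
definition "x * y =
  DPow (conv (+) (\<lambda>s t. of_nat (multi_choose s t)) (dpow_coeffs x) (dpow_coeffs y))"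

instance
proof
  fix a b c :: "'a dpow"
  show "a * b * c = a * (b * c)"
    by (simp add: times_dpow_def conv_assoc multi_choose_cocycle add.assoc flip: of_nat_mult)
  show "a * b = b * a"
    unfolding times_dpow_def
    by (subst conv_commute) (simp_all add: multi_choose_commute add.commute)
  show "1 * a = a"
    unfolding times_dpow_def one_dpow_def
    by (subst DPow_inverse [OF UNIV_I], subst conv_unit_left) (simp_all add: multi_choose_def)
  show "(0::'a dpow) \<noteq> 1"
    by (simp add: zero_dpow_def one_dpow_def del: single_one)
      (metis lookup_single_eq lookup_zero zero_neq_one)
qed (simp_all add: plus_dpow_def zero_dpow_def uminus_dpow_def minus_dpow_def times_dpow_def
    conv_add_left conv_add_right add_ac)

end

definition dpow_gen :: "nat \<Rightarrow> nat \<Rightarrow> 'a::comm_ring_1 dpow" where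
  "dpow_gen i t = DPow (Poly_Mapping.single (Poly_Mapping.single i t) 1)"

section \<open>Mod \<open>p\<close> homology and cohomology of elementary abelian groups\<close>

text \<open>
  The prime is \<open>p = CARD('p)\<close>, so \<open>'p mod_ring\<close> is the prime field. All generators \<open>e\<^sub>i, x\<^sub>i\<close>
  with \<open>i :: nat\<close> live in one type; \<open>cohomology n\<close> restricts to \<open>1 \<le> i \<le> n\<close>.
\<close>

type_synonym 'p mpoly = "(nat \<Rightarrow>\<^sub>0 nat) \<Rightarrow>\<^sub>0 'p mod_ring"
type_synonym 'p cohom = "'p mpoly ext"
type_synonym 'p homol = "'p mod_ring dpow ext"

definition xvar :: "nat \<Rightarrow> 'p::prime_card mpoly" where
  "xvar i = Poly_Mapping.single (Poly_Mapping.single i 1) 1"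

definition cohom_coeff :: "'p::prime_card cohom \<Rightarrow> nat fset \<Rightarrow> (nat \<Rightarrow>\<^sub>0 nat) \<Rightarrow> 'p mod_ring" where
  "cohom_coeff y A t = Poly_Mapping.lookup (ext_coeff y A) t"

definition cohomology :: "nat \<Rightarrow> 'p::prime_card cohom set" where
  "cohomology n = {y. \<forall>A t. cohom_coeff y A t \<noteq> 0 \<longrightarrow>
     fset A \<subseteq> {1..n} \<and> Poly_Mapping.keys t \<subseteq> {1..n}}"

definition homogeneous :: "nat \<Rightarrow> 'p::prime_card cohom \<Rightarrow> bool" where
  "homogeneous d y \<longleftrightarrow> (\<forall>A t. cohom_coeff y A t \<noteq> 0 \<longrightarrow>
     fcard A + 2 * (\<Sum>i\<in>Poly_Mapping.keys t. Poly_Mapping.lookup t i) = d)"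

definition cohom_scale :: "'p::prime_card mod_ring \<Rightarrow> 'p cohom \<Rightarrow> 'p cohom" where
  "cohom_scale c y = ext_const (Poly_Mapping.single 0 c) * y"

text \<open>
  The Kronecker pairing, under which the products
  \<open>u\<^sub>1\<^sup>\<epsilon>\<^sup>1 v\<^sub>1\<^sup>[\<^sup>t\<^sup>1\<^sup>] \<cdots>\<close> and \<open>e\<^sub>1\<^sup>\<epsilon>\<^sup>1 x\<^sub>1\<^sup>t\<^sup>1 \<cdots>\<close>
  (indices increasing) are dual bases. The Koszul convention for tensor products of dual spaces
  would change basis elements by signs only.
\<close>

definition pairing :: "'p::prime_card homol \<Rightarrow> 'p cohom \<Rightarrow> 'p mod_ring" where
  "pairing z y = (\<Sum>A\<in>Poly_Mapping.keys (ext_coeffs z).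
     \<Sum>t\<in>Poly_Mapping.keys (dpow_coeffs (ext_coeff z A)).
       Poly_Mapping.lookup (dpow_coeffs (ext_coeff z A)) t * cohom_coeff y A t)"

section \<open>Dickson and Mui invariants\<close>

definition bracket :: "nat list \<Rightarrow> 'p::prime_card mpoly" where
  "bracket rs = det (mat (length rs) (length rs) (\<lambda>(i, j). xvar (i + 1) ^ (CARD('p) ^ (rs ! j))))"

definition L_omit :: "nat \<Rightarrow> nat \<Rightarrow> 'p::prime_card mpoly" where
  "L_omit n i = bracket (filter (\<lambda>r. r \<noteq> i) [0..<n + 1])"

definition L_poly :: "nat \<Rightarrow> 'p::prime_card mpoly" where
  "L_poly n = L_omit n n"

definition dickson :: "nat \<Rightarrow> nat \<Rightarrow> 'p::prime_card mpoly fract" where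
  "dickson n i = Fract (L_omit n i) (L_poly n)"

text \<open>
  Row expansion of a determinant with entries in a noncommutative ring. Rows and columns are
  numbered from 1.
\<close>

definition row_det :: "nat \<Rightarrow> (nat \<Rightarrow> nat \<Rightarrow> 'a::ring_1) \<Rightarrow> 'a" where
  "row_det n a = (\<Sum>\<pi> | \<pi> permutes {1..n}.
     of_int (sign \<pi>) * prod_list (map (\<lambda>j. a j (\<pi> j)) [1..<n + 1]))"

definition mui_M :: "nat \<Rightarrow> nat \<Rightarrow> 'p::prime_card cohom" where
  "mui_M n s = row_det n (\<lambda>j i. if j = 1 then ext_gen i
     else ext_const (xvar i ^ (CARD('p) ^ (filter (\<lambda>r. r \<noteq> s) [0..<n] ! (j - 2)))))"

definition mui_R :: "nat \<Rightarrow> nat \<Rightarrow> 'p::prime_card cohom" where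
  "mui_R n s = mui_M n s * ext_const (L_poly n ^ (CARD('p) - 2))"

section \<open>The algebras and their duals\<close>

text \<open>
  The exterior algebra over the field of fractions of the polynomial ring contains the localization
  of the cohomology inverting \<open>q\<^sub>n\<^sub>,\<^sub>0\<close>, and \<open>to_loc\<close> embeds the cohomology in it.
\<close>

definition to_loc :: "'p::prime_card cohom \<Rightarrow> 'p mpoly fract ext" where
  "to_loc = map_coeffs (\<lambda>f. Fract f 1)"

type_synonym index = "(nat \<Rightarrow> nat) \<times> (nat \<Rightarrow> int)"

definition b_sum :: "nat \<Rightarrow> (nat \<Rightarrow> nat) \<Rightarrow> nat" where
  "b_sum n \<epsilon> = (\<Sum>s = 1..n. \<epsilon> s)"

text \<open>Both components are \<open>undefined\<close> outside \<open>{1..n}\<close>, so a sequence is represented once.\<close>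

definition indices :: "nat \<Rightarrow> nat \<Rightarrow> index set" where
  "indices n k = {(\<epsilon>, i). \<epsilon> \<in> {1..n} \<rightarrow>\<^sub>E {0, 1} \<and> i \<in> extensional {1..n} \<and>
     (\<forall>s\<in>{2..n}. 0 \<le> i s) \<and> int k \<le> 2 * i 1 + int (b_sum n \<epsilon>)}"

definition qmon_loc :: "nat \<Rightarrow> index \<Rightarrow> 'p::prime_card mpoly fract ext" where
  "qmon_loc n = (\<lambda>(\<epsilon>, i).
     prod_list (map (\<lambda>s. to_loc (mui_R n (s - 1)) ^ \<epsilon> s * ext_const (dickson n (s - 1) powi i s))
       [1..<n + 1]))"

text \<open>
  \<open>qmon n I\<close> is the monomial as an element of the cohomology: \<open>to_loc\<close> is injective, and a monomial
  with \<open>i 1 < 0\<close> and \<open>0 \<le> 2 * i 1 + b_sum n \<epsilon>\<close> has no denominator, since a product of \<open>m\<close> distinct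
  \<open>R\<^sub>n\<^sub>;\<^sub>s\<close> is divisible by the power of \<open>q\<^sub>n\<^sub>,\<^sub>0\<close> with exponent \<open>m - 1\<close>.
\<close>

definition qmon :: "nat \<Rightarrow> index \<Rightarrow> 'p::prime_card cohom" where
  "qmon n I = (THE y. y \<in> cohomology n \<and> to_loc y = qmon_loc n I)"

definition BB :: "nat \<Rightarrow> nat \<Rightarrow> 'p::prime_card cohom set" where
  "BB k n = module.span cohom_scale (qmon n ` indices n k)"

text \<open>
  Functionals on \<open>BB k n\<close> are represented by functions that vanish outside \<open>BB k n\<close>.
  The graded dual consists of those that vanish in all but finitely many degrees.
\<close>

definition BB_dual :: "nat \<Rightarrow> nat \<Rightarrow> ('p::prime_card cohom \<Rightarrow> 'p mod_ring) set" where
  "BB_dual k n = {\<phi>.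
     (\<forall>y. y \<notin> BB k n \<longrightarrow> \<phi> y = 0) \<and>
     (\<forall>y\<in>BB k n. \<forall>y'\<in>BB k n. \<phi> (y + y') = \<phi> y + \<phi> y') \<and>
     (\<forall>c. \<forall>y\<in>BB k n. \<phi> (cohom_scale c y) = c * \<phi> y) \<and>
     (\<exists>D. \<forall>d>D. \<forall>y\<in>BB k n. homogeneous d y \<longrightarrow> \<phi> y = 0)}"

definition dual_scale ::
  "'p::prime_card mod_ring \<Rightarrow> ('p cohom \<Rightarrow> 'p mod_ring) \<Rightarrow> 'p cohom \<Rightarrow> 'p mod_ring" where
  "dual_scale c \<phi> = (\<lambda>y. c * \<phi> y)"

definition dual_class :: "nat \<Rightarrow> nat \<Rightarrow> 'p::prime_card homol \<Rightarrow> 'p cohom \<Rightarrow> 'p mod_ring" where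
  "dual_class k n z = (\<lambda>y. if y \<in> BB k n then pairing z y else 0)"

text \<open>
  For the indices considered the exponents are nonnegative, so \<open>nat\<close> does not truncate.
\<close>

definition hom_mon :: "nat \<Rightarrow> index \<Rightarrow> 'p::prime_card homol" where
  "hom_mon n = (\<lambda>(\<epsilon>, i).
     let p = int CARD('p) in
     prod_list (map (\<lambda>s. ext_gen s ^ \<epsilon> s *
         ext_const (dpow_gen s (nat (p ^ (s - 1) * (p - 1) * ((\<Sum>j = 1..s. i j) + int (b_sum n \<epsilon>))
           - p ^ (s - 1) * int (\<epsilon> s)))))
       [1..<n + 1]))"

lemma vector_space_cohom_scale: "vector_space (cohom_scale :: 'p::prime_card mod_ring \<Rightarrow> _)"
proof -
  have add: "ext_const (u + v) = ext_const u + ext_const v" for u v :: "'p mpoly"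
    by (simp add: ext_const_def plus_ext_def single_add)
  have mult: "ext_const (u * v) = ext_const u * ext_const v" for u v :: "'p mpoly"
    by (simp add: ext_const_def times_ext_def conv_single shuffle_sign_def)
  have "Poly_Mapping.single 0 (c * d) = Poly_Mapping.single 0 c * (Poly_Mapping.single 0 d :: 'p mpoly)"
    for c d by (simp add: mult_single)
  moreover have one: "ext_const 1 = (1 :: 'p cohom)"
    by (simp add: ext_const_def one_ext_def)
  ultimately show ?thesis
    using one by unfold_locales (simp_all add: cohom_scale_def single_add add mult algebra_simps)
qed

lemma vector_space_dual_scale: "vector_space (dual_scale :: 'p::prime_card mod_ring \<Rightarrow> _)"
  by unfold_locales (simp_all add: dual_scale_def fun_eq_iff algebra_simps)

end

theory Submission
  imports Defs
begin

text \<open>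
  For a suitable monomial order, the trailing monomial of \<open>q\<^sup>I\<close> is exactly the monomial dual to the
  homology class attached to \<open>I\<close>, with coefficient \<open>\<plusminus>1\<close>, and distinct \<open>I\<close> have distinct trailing
  monomials. So the matrix of the pairing between the classes and the \<open>q\<^sup>I\<close> is triangular with
  invertible diagonal; since the \<open>q\<^sup>I\<close> are homogeneous and only finitely many of them have bounded
  degree, the classes form a basis of the graded dual. The trailing monomials of the determinants
  come from a single permutation, and those of the Dickson invariants from
  \<open>L\<^sub>n\<^sub>,\<^sub>i = L\<^sub>n q\<^sub>n\<^sub>,\<^sub>i\<close>.
\<close>

section \<open>Supports\<close>

text \<open>The exponents of the classes arise by adding trailing exponents. In the variable
  \<open>x_j\<close>, the invariant \<open>q_{n,i}\<close> contributes \<open>p^(j-1) (p-1)\<close>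
  if \<open>j > i\<close> and nothing otherwise, hence the partial sums
  \<open>i_1 + ... + i_s\<close>. A factor \<open>R_{n;s}\<close> contributes \<open>p^(j-1)\<close>
  from \<open>M_{n;s}\<close> and \<open>(p-2) p^(j-1)\<close> from the power of \<open>L_n\<close>,
  except that \<open>M_{n;s}\<close> supplies \<open>e_(s+1)\<close> instead of a power of
  \<open>x_(s+1)\<close>; hence \<open>b(I)\<close> and the correction by
  \<open>- p^(s-1) epsilon_s\<close>. Two obstacles shape the order. In \<open>M_{n;s}\<close> it
  must single out the term with \<open>e_(s+1)\<close>, which is why \<open>e_i\<close> ranks above
  \<open>x_i\<close> to the power \<open>p^(i-1)\<close> and below \<open>x_i\<close> to the power
  \<open>p^i\<close>. And since the \<open>e_i\<close> square to zero, trailing monomials multiply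
  only when their exterior parts are disjoint; here they are, because each \<open>R_{n;s}\<close>
  occurs at most once in \<open>q^I\<close> and brings its own generator.\<close>

definition supp :: "'p::prime_card cohom \<Rightarrow> (nat fset \<times> (nat \<Rightarrow>\<^sub>0 nat)) set" where
  "supp y = {(A, t). cohom_coeff y A t \<noteq> 0}"

definition cmon :: "'p::prime_card mod_ring \<Rightarrow> nat fset \<Rightarrow> (nat \<Rightarrow>\<^sub>0 nat) \<Rightarrow> 'p cohom" where
  "cmon c A t = Ext (Poly_Mapping.single A (Poly_Mapping.single t c))"

lemma ext_eqI: "(\<And>A. ext_coeff x A = ext_coeff y A) \<Longrightarrow> x = y"
  by (metis ext_coeff_def ext_coeffs_inverse poly_mapping_eqI)

lemma ext_coeff_simps [simp]:
  "ext_coeff (x + y) A = ext_coeff x A + ext_coeff y A"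
  "ext_coeff (x - y) A = ext_coeff x A - ext_coeff y A"
  "ext_coeff (- x) A = - ext_coeff x A"
  "ext_coeff 0 A = 0"
  by (simp_all add: ext_coeff_def plus_ext_def minus_ext_def uminus_ext_def zero_ext_def
      lookup_add lookup_minus)

lemma ext_coeff_mult:
  "ext_coeff (x * y) C = (\<Sum>A\<in>Poly_Mapping.keys (ext_coeffs x). \<Sum>B\<in>Poly_Mapping.keys (ext_coeffs y).
     (shuffle_sign A B * ext_coeff x A * ext_coeff y B when A |\<union>| B = C))"
  by (simp add: ext_coeff_def times_ext_def conv_def lookup_sum lookup_single)

lemma ext_const_mult: "ext_const (u * v) = ext_const u * ext_const v"
  by (simp add: ext_const_def times_ext_def conv_single shuffle_sign_def)

lemma ext_const_add: "ext_const (u + v) = ext_const u + ext_const v"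
  by (simp add: ext_const_def plus_ext_def single_add)

lemma ext_const_one [simp]: "ext_const 1 = 1"
  by (simp add: ext_const_def one_ext_def)

lemma ext_const_zero [simp]: "ext_const 0 = 0"
  by (simp add: ext_const_def zero_ext_def)

lemma ext_const_uminus: "ext_const (- u) = - ext_const u"
  by (simp add: ext_const_def uminus_ext_def single_uminus)

lemma ext_const_diff: "ext_const (u - v) = ext_const u - ext_const v"
  by (simp add: ext_const_def minus_ext_def single_diff)

lemma ext_const_power: "ext_const (u ^ m) = ext_const u ^ m"
  by (induction m) (simp_all add: ext_const_mult)

lemma ext_const_sum: "ext_const (sum f S) = (\<Sum>x\<in>S. ext_const (f x))"
  by (induction S rule: infinite_finite_induct) (simp_all add: ext_const_add)

lemma ext_const_prod_list: "ext_const (prod_list fs) = prod_list (map ext_const fs)"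
  by (induction fs) (simp_all add: ext_const_mult)

lemma ext_coeff_const: "ext_coeff (ext_const u) A = (if A = {||} then u else 0)"
  by (simp add: ext_coeff_def ext_const_def lookup_single when_def)

lemma ext_const_central: "ext_const u * y = y * ext_const u"
proof -
  have *: "conv (|\<union>|) shuffle_sign (Poly_Mapping.single {||} u) f
      = conv (|\<union>|) shuffle_sign f (Poly_Mapping.single {||} u)" for f
    by (induction f rule: poly_mapping_induct_single)
      (simp_all add: conv_single conv_add_left conv_add_right shuffle_sign_def mult.commute)
  show ?thesis by (simp add: ext_const_def times_ext_def *)
qed

lemma cohom_coeff_simps [simp]:
  "cohom_coeff (x + y) A t = cohom_coeff x A t + cohom_coeff y A t"
  "cohom_coeff (x - y) A t = cohom_coeff x A t - cohom_coeff y A t"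
  "cohom_coeff (- x) A t = - cohom_coeff x A t"
  "cohom_coeff 0 A t = 0"
  by (simp_all add: cohom_coeff_def lookup_add lookup_minus)

lemma cohom_coeff_sum: "cohom_coeff (sum f S) A t = (\<Sum>x\<in>S. cohom_coeff (f x) A t)"
  by (induction S rule: infinite_finite_induct) simp_all

lemma cohom_eqI: "(\<And>A t. cohom_coeff x A t = cohom_coeff y A t) \<Longrightarrow> x = y"
  by (rule ext_eqI) (simp add: cohom_coeff_def poly_mapping_eqI)

lemma cohom_coeff_const:
  "cohom_coeff (ext_const f) A t = (if A = {||} then Poly_Mapping.lookup f t else 0)"
  by (simp add: cohom_coeff_def ext_coeff_const)

lemma cohom_coeff_cmon: "cohom_coeff (cmon c A t) B s = (if B = A \<and> s = t then c else 0)"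
  by (auto simp add: cohom_coeff_def ext_coeff_def cmon_def lookup_single when_def)

lemma finite_supp: "finite (supp y)"
proof -
  have "supp y \<subseteq> (SIGMA A : Poly_Mapping.keys (ext_coeffs y). Poly_Mapping.keys (ext_coeff y A))"
    by (auto simp: supp_def cohom_coeff_def ext_coeff_def in_keys_iff)
  then show ?thesis by (rule finite_subset) simp
qed

lemma supp_empty_iff: "supp y = {} \<longleftrightarrow> y = 0"
  by (auto simp: supp_def intro!: cohom_eqI)

lemma supp_add: "supp (x + y) \<subseteq> supp x \<union> supp y"
  and supp_uminus: "supp (- x) = supp x"
  by (auto simp: supp_def)

lemma supp_sum: "supp (sum f S) \<subseteq> (\<Union>x\<in>S. supp (f x))"
  by (auto simp: supp_def cohom_coeff_sum) (metis (mono_tags, lifting) sum.neutral)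

lemma supp_cmon: "supp (cmon c A t) = (if c = 0 then {} else {(A, t)})"
  by (auto simp: supp_def cohom_coeff_cmon split: if_splits)

lemma shuffle_sign_cases:
  assumes "A |\<inter>| B = {||}"
  shows "shuffle_sign A B = (1::'a::comm_ring_1) \<or> shuffle_sign A B = (-1 :: 'a)"
  using assms by (simp add: shuffle_sign_def minus_one_power_iff)

lemma supp_mult:
  fixes x y :: "'p::prime_card cohom"
  shows "supp (x * y) \<subseteq> {(A |\<union>| B, s + t) | A B s t. A |\<inter>| B = {||} \<and> (A, s) \<in> supp x \<and> (B, t) \<in> supp y}"
proof (clarify)
  fix C r assume "(C, r) \<in> supp (x * y)"
  then have "Poly_Mapping.lookup (ext_coeff (x * y) C) r \<noteq> 0"
    by (simp add: supp_def cohom_coeff_def)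
  then have "(\<Sum>A\<in>Poly_Mapping.keys (ext_coeffs x). \<Sum>B\<in>Poly_Mapping.keys (ext_coeffs y).
     Poly_Mapping.lookup (shuffle_sign A B * ext_coeff x A * ext_coeff y B when A |\<union>| B = C) r) \<noteq> 0"
    by (simp add: ext_coeff_mult lookup_sum)
  then obtain A B where "Poly_Mapping.lookup (shuffle_sign A B * ext_coeff x A * ext_coeff y B when A |\<union>| B = C) r \<noteq> 0"
    by (meson sum.not_neutral_contains_not_neutral)
  then have C: "A |\<union>| B = C" and nz: "Poly_Mapping.lookup (shuffle_sign A B * ext_coeff x A * ext_coeff y B) r \<noteq> 0"
    by (auto simp: when_def split: if_splits)
  then have disj: "A |\<inter>| B = {||}"
    by (auto simp: shuffle_sign_def split: if_splits)
  from shuffle_sign_cases[OF this, where 'a = "'p mpoly"] nz have "Poly_Mapping.lookup (ext_coeff x A * ext_coeff y B) r \<noteq> 0"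
    by (auto simp: lookup_uminus)
  then have "r \<in> Poly_Mapping.keys (ext_coeff x A * ext_coeff y B)"
    by (simp add: in_keys_iff)
  then obtain s t where "r = s + t" "s \<in> Poly_Mapping.keys (ext_coeff x A)" "t \<in> Poly_Mapping.keys (ext_coeff y B)"
    using keys_mult by blast
  then show "\<exists>A B s t. (C, r) = (A |\<union>| B, s + t) \<and> A |\<inter>| B = {||} \<and> (A, s) \<in> supp x \<and> (B, t) \<in> supp y"
    using C disj by (auto simp: supp_def cohom_coeff_def in_keys_iff)
qed

lemma cmon_mult:
  assumes "A |\<inter>| B = {||}"
  shows "\<exists>e\<in>{1,-1}. cmon c A s * cmon d B t = cmon (e * c * d) (A |\<union>| B) (s + t)"
  using shuffle_sign_cases[OF assms, where 'a = "'a mpoly"]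
  by (auto simp: cmon_def times_ext_def conv_single mult_single single_uminus[symmetric])

section \<open>Trailing monomials\<close>

text \<open>
  Weights are compared in the lexicographic order of poly mappings, in which the smallest index is
  the most significant one. A factor \<open>x\<^sub>i\<close> has weight \<open>2\<close> at \<open>i\<close>; the generator \<open>e\<^sub>i\<close> is placed strictly
  between \<open>x\<^sub>i\<close> raised to \<open>p\<^sup>i\<^sup>-\<^sup>1\<close> and \<open>x\<^sub>i\<close> raised to \<open>p\<^sup>i\<close>, and the parity at \<open>i\<close> records whether it occurs.
\<close>

definition wt :: "nat \<Rightarrow> nat fset \<Rightarrow> (nat \<Rightarrow>\<^sub>0 nat) \<Rightarrow> (nat \<Rightarrow>\<^sub>0 nat)" where
  "wt p A t = t + t + (\<Sum>i\<in>fset A. Poly_Mapping.single i (2 * p ^ (i - 1) + 1))"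

lemma lookup_wt:
  "Poly_Mapping.lookup (wt p A t) i
     = 2 * Poly_Mapping.lookup t i + (if i |\<in>| A then 2 * p ^ (i - 1) + 1 else 0)"
  by (simp add: wt_def lookup_add lookup_sum lookup_single when_def)

lemma wt_mult:
  assumes "A |\<inter>| B = {||}"
  shows "wt p (A |\<union>| B) (s + t) = wt p A s + wt p B t"
  using assms by (intro poly_mapping_eqI) (auto simp: lookup_wt lookup_add)

text \<open>Injectivity turns the linear order of weights into a linear order of monomials, so a
  nonzero element has exactly one trailing monomial.\<close>

lemma wt_inject:
  assumes "wt p A s = wt p B t"
  shows "A = B \<and> s = t"
proof -
  have *: "2 * Poly_Mapping.lookup s i + (if i |\<in>| A then 2 * p ^ (i - 1) + 1 else 0)
    = 2 * Poly_Mapping.lookup t i + (if i |\<in>| B then 2 * p ^ (i - 1) + 1 else 0)" for i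
    using assms by (metis lookup_wt)
  have m: "i |\<in>| A \<longleftrightarrow> i |\<in>| B" for i
    using *[of i] by (cases "i |\<in>| A"; cases "i |\<in>| B"; simp) presburger+
  then have "A = B" by blast
  moreover have "s = t"
    using * by (intro poly_mapping_eqI) (simp add: m split: if_splits)
  ultimately show ?thesis by simp
qed

text \<open>Only the nonvanishing of the coefficient is recorded; over a field this is enough to
  invert a triangular matrix.\<close>

definition trailing :: "'p::prime_card cohom \<Rightarrow> nat fset \<Rightarrow> (nat \<Rightarrow>\<^sub>0 nat) \<Rightarrow> bool" where
  "trailing y A t \<longleftrightarrow> (A, t) \<in> supp y \<and>
     (\<forall>(B, s)\<in>supp y. (B, s) \<noteq> (A, t) \<longrightarrow> wt CARD('p) A t < wt CARD('p) B s)"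

lemma trailing_exists:
  assumes "y \<noteq> 0"
  shows "\<exists>A t. trailing (y :: 'p::prime_card cohom) A t"
proof -
  let ?W = "\<lambda>(A, t). wt CARD('p) A t"
  have "finite (?W ` supp y)" "?W ` supp y \<noteq> {}"
    using assms by (auto simp: finite_supp supp_empty_iff)
  then have "Min (?W ` supp y) \<in> ?W ` supp y" "\<forall>w\<in>?W ` supp y. Min (?W ` supp y) \<le> w"
    by auto
  then obtain A t where At: "(A, t) \<in> supp y" "\<forall>w\<in>?W ` supp y. wt CARD('p) A t \<le> w"
    by auto
  then show ?thesis
    unfolding trailing_def using wt_inject by (fastforce simp: le_less)
qed

lemma trailing_less:
  fixes y :: "'p::prime_card cohom"
  assumes "trailing y A t" "(B, s) \<in> supp y" "(B, s) \<noteq> (A, t)"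
  shows "wt CARD('p) A t < wt CARD('p) B s"
  using assms by (auto simp: trailing_def)

lemma trailing_supp: "trailing y A t \<Longrightarrow> (A, t) \<in> supp y"
  by (simp add: trailing_def)

lemma trailing_unique:
  assumes "trailing y A t" "trailing y B s"
  shows "A = B \<and> t = s"
  using trailing_less[OF assms(1) trailing_supp[OF assms(2)]]
    trailing_less[OF assms(2) trailing_supp[OF assms(1)]]
  by (metis less_asym prod.inject)

text \<open>Weights add up on disjoint exterior parts and their order is compatible with addition.
  Disjointness also keeps the product of the two trailing terms from vanishing.\<close>

lemma trailing_mult:
  fixes x y :: "'p::prime_card cohom"
  assumes "trailing x A s" "trailing y B t" and disj: "A |\<inter>| B = {||}"
  shows "trailing (x * y) (A |\<union>| B) (s + t)"
proof -
  let ?W = "wt CARD('p)"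
  define c d where "c = cohom_coeff x A s" and "d = cohom_coeff y B t"
  have cd: "c \<noteq> 0" "d \<noteq> 0"
    using assms by (auto simp: c_def d_def trailing_def supp_def)
  define x' y' where "x' = x - cmon c A s" and "y' = y - cmon d B t"
  have x': "?W A s < ?W A' s'" if "(A', s') \<in> supp x'" for A' s'
    using that assms(1) by (auto simp: x'_def supp_def c_def trailing_def cohom_coeff_cmon split: if_splits)
  have y': "?W B t < ?W B' t'" if "(B', t') \<in> supp y'" for B' t'
    using that assms(2) by (auto simp: y'_def supp_def d_def trailing_def cohom_coeff_cmon split: if_splits)
  have x: "?W A s \<le> ?W A' s'" if "(A', s') \<in> supp x" for A' s'
    using that assms(1) unfolding trailing_def by (cases "(A', s') = (A, s)") auto
  obtain e where e: "e \<in> {1, -1}" "cmon c A s * cmon d B t = cmon (e * c * d) (A |\<union>| B) (s + t)"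
    using cmon_mult[OF disj] by blast
  \<comment> \<open>In each of the two products at least one factor lies strictly above its trailing
    monomial, so no term of \<open>r\<close> can cancel the leading product.\<close>
  define r where "r = x * y' + x' * cmon d B t"
  have xy: "x * y = cmon (e * c * d) (A |\<union>| B) (s + t) + r"
    unfolding e(2)[symmetric] by (simp add: r_def x'_def y'_def right_diff_distrib left_diff_distrib)
  have r: "?W (A |\<union>| B) (s + t) < ?W C u" if "(C, u) \<in> supp r" for C u
  proof -
    from that have "(C, u) \<in> supp (x * y') \<or> (C, u) \<in> supp (x' * cmon d B t)"
      unfolding r_def using supp_add by blast
    then show ?thesis
    proof
      assume "(C, u) \<in> supp (x * y')"
      from subsetD[OF supp_mult this] obtain A' B' s' t' where
        *: "C = A' |\<union>| B'" "u = s' + t'" "A' |\<inter>| B' = {||}" "(A', s') \<in> supp x" "(B', t') \<in> supp y'"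
        by blast
      show ?thesis
        unfolding *(1,2) wt_mult[OF *(3)] wt_mult[OF disj]
        by (rule add_le_less_mono[OF x[OF *(4)] y'[OF *(5)]])
    next
      assume "(C, u) \<in> supp (x' * cmon d B t)"
      from subsetD[OF supp_mult this] obtain A' s' where
        *: "C = A' |\<union>| B" "u = s' + t" "A' |\<inter>| B = {||}" "(A', s') \<in> supp x'"
        using cd by (auto simp: supp_cmon)
      show ?thesis
        unfolding *(1,2) wt_mult[OF *(3)] wt_mult[OF disj]
        using x'[OF *(4)] by simp
    qed
  qed
  have "e * c * d \<noteq> 0" using e cd by auto
  moreover have "(A |\<union>| B, s + t) \<notin> supp r" using r by blast
  ultimately have "(A |\<union>| B, s + t) \<in> supp (x * y)"
    by (simp add: xy supp_def cohom_coeff_cmon)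
  moreover have "?W (A |\<union>| B) (s + t) < ?W C u" if "(C, u) \<in> supp (x * y)" "(C, u) \<noteq> (A |\<union>| B, s + t)" for C u
    using that r[of C u] by (auto simp: xy supp_def cohom_coeff_cmon split: if_splits)
  ultimately show ?thesis unfolding trailing_def by auto
qed

lemma trailing_one: "trailing 1 {||} 0"
  by (auto simp: trailing_def supp_def cohom_coeff_const ext_const_one[symmetric] lookup_one when_def
    simp del: ext_const_one split: if_splits)

lemma trailing_power: "trailing y {||} t \<Longrightarrow> trailing (y ^ m) {||} (\<Sum>_<m. t)"
proof (induction m)
  case (Suc m)
  then show ?case
    using trailing_mult[OF Suc.prems Suc.IH[OF Suc.prems]] by (simp add: add.commute del: sum_constant)
qed (simp add: trailing_one)

section \<open>Homogeneous elements\<close>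

definition tdeg :: "(nat \<Rightarrow>\<^sub>0 nat) \<Rightarrow> nat" where
  "tdeg t = (\<Sum>i\<in>Poly_Mapping.keys t. Poly_Mapping.lookup t i)"

lemma tdeg_superset:
  "finite K \<Longrightarrow> Poly_Mapping.keys t \<subseteq> K \<Longrightarrow> tdeg t = (\<Sum>i\<in>K. Poly_Mapping.lookup t i)"
  unfolding tdeg_def by (rule sum.mono_neutral_left) (auto simp: in_keys_iff)

lemma tdeg_add: "tdeg (s + t) = tdeg s + tdeg t"
proof -
  let ?K = "Poly_Mapping.keys s \<union> Poly_Mapping.keys t"
  have "Poly_Mapping.keys (s + t) \<subseteq> ?K" by (rule keys_add)
  then show ?thesis by (simp add: tdeg_superset[of ?K] lookup_add sum.distrib)
qed

lemma tdeg_single [simp]: "tdeg (Poly_Mapping.single i m) = m"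
  by (simp add: tdeg_def)

lemma tdeg_zero [simp]: "tdeg 0 = 0"
  by (simp add: tdeg_def)

definition homog :: "nat \<Rightarrow> nat \<Rightarrow> 'p::prime_card cohom \<Rightarrow> bool" where
  "homog n d y \<longleftrightarrow> (\<forall>(A, t)\<in>supp y. fset A \<subseteq> {1..n} \<and> Poly_Mapping.keys t \<subseteq> {1..n} \<and>
     fcard A + 2 * tdeg t = d)"

lemma homog_iff: "homog n d y \<longleftrightarrow> y \<in> cohomology n \<and> homogeneous d y"
  by (simp add: homog_def cohomology_def homogeneous_def supp_def tdeg_def imp_conjR all_conj_distrib)

lemma homog_add: "homog n d x \<Longrightarrow> homog n d y \<Longrightarrow> homog n d (x + y)"
  using supp_add[of x y] by (fastforce simp: homog_def)

lemma homog_uminus: "homog n d x \<Longrightarrow> homog n d (- x)"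
  by (simp add: homog_def supp_uminus)

lemma homog_diff: "homog n d x \<Longrightarrow> homog n d y \<Longrightarrow> homog n d (x - y)"
  using homog_add[of n d x "- y"] homog_uminus[of n d y] by simp

lemma homog_zero [simp]: "homog n d 0"
  by (simp add: homog_def supp_def)

lemma homog_sum: "(\<And>x. x \<in> S \<Longrightarrow> homog n d (f x)) \<Longrightarrow> homog n d (sum f S)"
  by (induction S rule: infinite_finite_induct) (auto intro: homog_add)

lemma homog_mult:
  assumes "homog n d x" "homog n e y"
  shows "homog n (d + e) (x * y)"
  unfolding homog_def
proof clarify
  fix C r assume "(C, r) \<in> supp (x * y)"
  from subsetD[OF supp_mult this] obtain A B s t where
    *: "C = A |\<union>| B" "r = s + t" "A |\<inter>| B = {||}" "(A, s) \<in> supp x" "(B, t) \<in> supp y"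
    by blast
  have "fcard C = fcard A + fcard B"
    using fcard_funion_fsubset[of A B] fcard_funion_finter[of A B] *(1,3) by simp
  moreover have "Poly_Mapping.keys r \<subseteq> Poly_Mapping.keys s \<union> Poly_Mapping.keys t"
    unfolding *(2) by (rule keys_add)
  ultimately show "fset C \<subseteq> {1..n} \<and> Poly_Mapping.keys r \<subseteq> {1..n} \<and> fcard C + 2 * tdeg r = d + e"
    using assms *(4,5) unfolding *(1,2) homog_def by (fastforce simp: tdeg_add)
qed

lemma homog_one: "homog n 0 1"
  by (auto simp: homog_def supp_def cohom_coeff_const ext_const_one[symmetric] lookup_one when_def
    simp del: ext_const_one split: if_splits)

lemma homog_power: "homog n d y \<Longrightarrow> homog n (m * d) (y ^ m)"
  by (induction m) (auto intro: homog_mult homog_one)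

lemma homog_mono: "homog m d y \<Longrightarrow> m \<le> n \<Longrightarrow> homog n d y"
  unfolding homog_def by fastforce

lemma homog_xvar: "1 \<le> i \<Longrightarrow> i \<le> n \<Longrightarrow> homog n 2 (ext_const (xvar i))"
  by (auto simp: homog_def supp_def cohom_coeff_const xvar_def lookup_single when_def split: if_splits)

section \<open>Dickson polynomials\<close>

lemma CHAR_mod_ring: "CHAR('p::prime_card mod_ring) = CARD('p)"
proof -
  have dvd: "CHAR('p mod_ring) dvd CARD('p)"
    using of_nat_card_eq_0[where 'a = 'p] by (simp add: of_nat_eq_0_iff_char_dvd)
  have "CHAR('p mod_ring) \<noteq> 1"
    by (metis of_nat_1 of_nat_CHAR zero_neq_one)
  with dvd show ?thesis
    using prime_card[where 'a = 'p] by (metis prime_nat_iff)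
qed

lemma CHAR_mpoly: "CHAR('p::prime_card mpoly) = CARD('p)"
proof -
  have "of_nat m = (0 :: 'p mpoly) \<longleftrightarrow> of_nat m = (0 :: 'p mod_ring)" for m
  proof -
    have "of_nat m = (0 :: 'p mpoly) \<longleftrightarrow> Poly_Mapping.single 0 (of_nat m :: 'p mod_ring) = (0 :: 'p mpoly)"
      by (simp only: single_of_nat)
    also have "\<dots> \<longleftrightarrow> of_nat m = (0 :: 'p mod_ring)"
      by (metis lookup_single_eq lookup_zero single_zero)
    finally show ?thesis .
  qed
  then show ?thesis
    unfolding CHAR_mod_ring[symmetric]
    by (intro CHAR_eqI) (auto simp: of_nat_eq_0_iff_char_dvd)
qed

lemma frobenius_sum:
  "(\<Sum>x\<in>S. f x) ^ (CARD('p) ^ r) = (\<Sum>x\<in>S. f x ^ (CARD('p) ^ r) :: 'p::prime_card mpoly)"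
  by (rule freshmans_dream_sum') (simp_all add: CHAR_mpoly prime_card)

text \<open>
  \<open>dcoeff n i\<close> is the coefficient of \<open>X\<close> to the power \<open>p\<^sup>i\<close> in the monic additive polynomial \<open>f\<^sub>n\<close> of degree \<open>p\<^sup>n\<close>
  that vanishes on the span of \<open>x\<^sub>1, \<dots>, x\<^sub>n\<close>. The recursion is
  \<open>f\<^sub>n(X) = f\<^sub>n\<^sub>-\<^sub>1(X)\<^sup>p - f\<^sub>n\<^sub>-\<^sub>1(x\<^sub>n)\<^sup>p\<^sup>-\<^sup>1 f\<^sub>n\<^sub>-\<^sub>1(X)\<close>.
\<close>

fun dcoeff :: "nat \<Rightarrow> nat \<Rightarrow> 'p::prime_card mpoly" where
  "dcoeff 0 i = (if i = 0 then 1 else 0)"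
| "dcoeff (Suc n) i = (case i of 0 \<Rightarrow> 0 | Suc j \<Rightarrow> dcoeff n j ^ CARD('p))
     - (\<Sum>j\<le>n. dcoeff n j * xvar (Suc n) ^ (CARD('p) ^ j)) ^ (CARD('p) - 1) * dcoeff n i"

declare dcoeff.simps(2) [simp del]

lemma dcoeff_zero: "n < i \<Longrightarrow> dcoeff n i = (0 :: 'p::prime_card mpoly)"
proof (induction n arbitrary: i)
  case (Suc n)
  have "CARD('p) > 0" using prime_card[where 'a='p] prime_gt_0_nat by blast
  then show ?case using Suc by (auto simp: dcoeff.simps(2) split: nat.splits)
qed simp

lemma dcoeff_diag: "dcoeff n n = (1 :: 'p::prime_card mpoly)"
  by (induction n) (simp_all add: dcoeff.simps(2) dcoeff_zero)

text \<open>The value at \<open>X\<close> of the additive polynomial \<open>f_n\<close>.\<close>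

definition dpoly :: "nat \<Rightarrow> 'p::prime_card mpoly \<Rightarrow> 'p mpoly" where
  "dpoly n X = (\<Sum>j\<le>n. dcoeff n j * X ^ (CARD('p) ^ j))"

text \<open>The Frobenius map acts termwise on \<open>f_n(X)\<close>, raising the coefficients to
  the power \<open>p\<close> and moving the exponent \<open>p^j\<close> to \<open>p^(j+1)\<close>;
  this shift is the \<open>case\<close> distinction in the recursion of
  \<open>dcoeff\<close>.\<close>

lemma dpoly_Suc:
  "dpoly (Suc n) X = dpoly n X ^ CARD('p)
     - dpoly n (xvar (Suc n)) ^ (CARD('p) - 1) * dpoly n (X :: 'p::prime_card mpoly)"
proof -
  let ?p = "CARD('p)"
  let ?c = "dpoly n (xvar (Suc n)) ^ (?p - 1) :: 'p mpoly"
  have "dpoly (Suc n) X = (\<Sum>j\<le>Suc n. (case j of 0 \<Rightarrow> 0 | Suc j \<Rightarrow> dcoeff n j ^ ?p) * X ^ (?p ^ j))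
      - (\<Sum>j\<le>Suc n. ?c * (dcoeff n j * X ^ (?p ^ j)))"
    by (simp only: dpoly_def dcoeff.simps(2) left_diff_distrib sum_subtractf mult.assoc)
  also have "(\<Sum>j\<le>Suc n. (case j of 0 \<Rightarrow> 0 | Suc j \<Rightarrow> dcoeff n j ^ ?p) * X ^ (?p ^ j))
      = (\<Sum>j\<le>n. dcoeff n j ^ ?p * X ^ (?p ^ Suc j))"
    by (subst sum.atMost_Suc_shift) simp
  also have "\<dots> = (\<Sum>j\<le>n. (dcoeff n j * X ^ (?p ^ j)) ^ ?p)"
    by (intro sum.cong refl) (simp add: power_mult_distrib power_mult[symmetric] mult.commute)
  also have "\<dots> = dpoly n X ^ ?p"
    by (simp add: dpoly_def frobenius_sum[where r = 1, simplified])
  also have "(\<Sum>j\<le>Suc n. ?c * (dcoeff n j * X ^ (?p ^ j))) = ?c * dpoly n X"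
    by (simp add: dpoly_def dcoeff_zero sum_distrib_left)
  finally show ?thesis .
qed

text \<open>For the new variable the two terms of the recursion cancel; for an older one both
  contain a positive power of a value that vanishes by induction.\<close>

lemma dpoly_root: "1 \<le> i \<Longrightarrow> i \<le> n \<Longrightarrow> dpoly n (xvar i :: 'p::prime_card mpoly) = 0"
proof (induction n)
  case (Suc n)
  have p: "CARD('p) > 0" using prime_card[where 'a='p] prime_gt_0_nat by blast
  show ?case
  proof (cases "i = Suc n")
    case True
    have "(y :: 'p mpoly) ^ CARD('p) = y ^ (CARD('p) - 1) * y" for y
      using p by (metis power_minus_mult)
    then show ?thesis by (simp add: dpoly_Suc True)
  qed (use Suc p in \<open>simp add: dpoly_Suc\<close>)
qed simp

text \<open>With \<open>X\<close> in degree 2 the polynomial \<open>f_n\<close> is homogeneous of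
  degree \<open>2 p^n\<close>, which leaves this degree for the coefficient of \<open>X\<close> to
  the power \<open>p^i\<close>. Homogeneity of the Dickson invariants is taken from here, so that no
  quotient has to be examined.\<close>

lemma homog_dcoeff:
  "i \<le> n \<Longrightarrow> homog n (2 * (CARD('p) ^ n - CARD('p) ^ i)) (ext_const (dcoeff n i :: 'p::prime_card mpoly))"
proof (induction n arbitrary: i)
  case 0
  then show ?case by (simp add: homog_one)
next
  case (Suc n)
  let ?p = "CARD('p)"
  have p: "?p > 1" using prime_card[where 'a='p] prime_gt_1_nat by blast
  let ?P = "\<Sum>j\<le>n. dcoeff n j * xvar (Suc n) ^ (?p ^ j) :: 'p mpoly"
  have P: "homog (Suc n) (2 * ?p ^ n) (ext_const ?P)"
    unfolding ext_const_sum
  proof (rule homog_sum)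
    fix j assume "j \<in> {..n}"
    then have j: "j \<le> n" by simp
    then have "?p ^ j \<le> ?p ^ n" using p by (simp add: power_increasing)
    then have "2 * (?p ^ n - ?p ^ j) + ?p ^ j * 2 = 2 * ?p ^ n" by simp
    then show "homog (Suc n) (2 * ?p ^ n) (ext_const (dcoeff n j * xvar (Suc n) ^ (?p ^ j) :: 'p mpoly))"
      using homog_mult[OF homog_mono[OF Suc.IH[OF j], of "Suc n"] homog_power[OF homog_xvar[of "Suc n" "Suc n"], of "?p ^ j"]]
      by (simp add: ext_const_mult ext_const_power)
  qed
  have 1: "homog (Suc n) (2 * (?p ^ Suc n - ?p ^ i))
      (ext_const ((case i of 0 \<Rightarrow> 0 | Suc j \<Rightarrow> dcoeff n j ^ ?p) :: 'p mpoly))"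
  proof (cases i)
    case (Suc j)
    then have "j \<le> n" using Suc.prems by simp
    from homog_power[OF homog_mono[OF Suc.IH[OF this], of "Suc n"], of ?p]
    show ?thesis using Suc by (simp add: ext_const_power diff_mult_distrib2 mult.left_commute)
  qed simp
  have 2: "homog (Suc n) (2 * (?p ^ Suc n - ?p ^ i)) (ext_const (?P ^ (?p - 1) * dcoeff n i))"
  proof (cases "i = Suc n")
    case False
    then have i: "i \<le> n" using Suc.prems by simp
    then have le: "?p ^ i \<le> ?p ^ n" using p by (simp add: power_increasing)
    have "?p ^ Suc n = (?p - 1) * ?p ^ n + ?p ^ n"
      using p by (simp add: diff_mult_distrib)
    then have "(?p - 1) * (2 * ?p ^ n) + 2 * (?p ^ n - ?p ^ i) = 2 * (?p ^ Suc n - ?p ^ i)"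
      using le by simp
    then show ?thesis
      using homog_mult[OF homog_power[OF P, of "?p - 1"] homog_mono[OF Suc.IH[OF i], of "Suc n"]]
      by (simp add: ext_const_mult ext_const_power)
  qed (simp add: dcoeff_zero)
  show ?case
    unfolding dcoeff.simps(2) ext_const_diff by (rule homog_diff[OF 1 2])
qed

section \<open>Trailing monomials of the determinants\<close>

text \<open>Reduces a strict lexicographic comparison to a greedy argument: it is enough to be no
  worse at each position where everything before agrees.\<close>

lemma poly_mapping_lessI:
  fixes u v :: "nat \<Rightarrow>\<^sub>0 nat"
  assumes "u \<noteq> v"
    and "\<And>i. (\<And>i'. i' < i \<Longrightarrow> Poly_Mapping.lookup u i' = Poly_Mapping.lookup v i') \<Longrightarrow>
      Poly_Mapping.lookup u i \<le> Poly_Mapping.lookup v i"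
  shows "u < v"
proof (rule ccontr)
  assume "\<not> u < v"
  with assms(1) have "v < u" by simp
  then obtain k where "Poly_Mapping.lookup v k < Poly_Mapping.lookup u k"
    "\<And>k'. k' < k \<Longrightarrow> Poly_Mapping.lookup v k' = Poly_Mapping.lookup u k'"
    by (auto simp: less_poly_mapping.rep_eq less_fun_def)
  then show False using assms(2)[of k] by fastforce
qed

definition expo :: "nat \<Rightarrow> (nat \<Rightarrow> nat) \<Rightarrow> (nat \<Rightarrow>\<^sub>0 nat)" where
  "expo n f = (\<Sum>j = 1..n. Poly_Mapping.single j (f j))"

lemma lookup_expo: "Poly_Mapping.lookup (expo n f) j = (if 1 \<le> j \<and> j \<le> n then f j else 0)"
  by (simp add: expo_def lookup_sum lookup_single when_def)

lemma keys_expo: "Poly_Mapping.keys (expo n f) \<subseteq> {1..n}"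
  by (auto simp: in_keys_iff lookup_expo split: if_splits)

lemma expo_add: "expo n f + expo n g = expo n (\<lambda>j. f j + g j)"
  by (rule poly_mapping_eqI) (simp add: lookup_expo lookup_add)

lemma expo_power: "(\<Sum>_<m. expo n f) = expo n (\<lambda>j. m * f j)"
  by (rule poly_mapping_eqI, subst lookup_sum) (simp add: lookup_expo)

lemma expo_cong: "(\<And>j. 1 \<le> j \<Longrightarrow> j \<le> n \<Longrightarrow> f j = g j) \<Longrightarrow> expo n f = expo n g"
  by (simp add: expo_def)

lemma tdeg_expo: "tdeg (expo n f) = (\<Sum>j = 1..n. f j)"
  using keys_expo by (subst tdeg_superset[of "{1..n}"]) (auto simp: lookup_expo)

lemma trailing_sum:
  fixes f :: "'b \<Rightarrow> 'p::prime_card cohom"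
  assumes "finite S" "x0 \<in> S" "trailing (f x0) A t"
    and "\<And>x B s. x \<in> S \<Longrightarrow> x \<noteq> x0 \<Longrightarrow> (B, s) \<in> supp (f x) \<Longrightarrow> wt CARD('p) A t < wt CARD('p) B s"
  shows "trailing (sum f S) A t"
proof -
  define r where "r = sum f (S - {x0})"
  have split: "sum f S = f x0 + r"
    unfolding r_def using assms(1,2) by (rule sum.remove)
  have r: "wt CARD('p) A t < wt CARD('p) B s" if "(B, s) \<in> supp r" for B s
    using subsetD[OF supp_sum that[unfolded r_def]] assms(4) by auto
  have "(A, t) \<notin> supp r" using r by blast
  then have "(A, t) \<in> supp (sum f S)"
    using trailing_supp[OF assms(3)] by (simp add: split supp_def)
  moreover have "wt CARD('p) A t < wt CARD('p) B s"
    if "(B, s) \<in> supp (sum f S)" "(B, s) \<noteq> (A, t)" for B s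
    using that r[of B s] trailing_less[OF assms(3), of B s] supp_add[of "f x0" r]
    unfolding split by blast
  ultimately show ?thesis by (auto simp: trailing_def)
qed

lemma trailing_cmon: "c \<noteq> 0 \<Longrightarrow> trailing (cmon c A t) A t"
  by (simp add: trailing_def supp_cmon)

lemma cmon_uminus: "cmon (- c) A t = - cmon c A t"
  by (rule cohom_eqI) (simp add: cohom_coeff_cmon)

lemma cmon_const: "ext_const (Poly_Mapping.single t c) = cmon c {||} t"
  by (simp add: ext_const_def cmon_def)

lemma sign_cmon: "of_int (sign \<pi>) * cmon c A t = cmon (of_int (sign \<pi>) * c) A t"
  by (cases "sign \<pi> = 1") (auto simp: cmon_uminus sign_def)

lemma of_int_sign_neq_0: "of_int (sign \<pi>) \<noteq> (0 :: 'a::ring_1)"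
  by (simp add: sign_def)

lemma xvar_power: "xvar i ^ m = (Poly_Mapping.single (Poly_Mapping.single i m) 1 :: 'p::prime_card mpoly)"
proof (induction m)
  case (Suc m)
  then show ?case by (simp add: xvar_def mult_single single_add[symmetric] add.commute)
qed (simp add: xvar_def)

lemma prod_single: "(\<Prod>x\<in>S. Poly_Mapping.single (g x) 1) = (Poly_Mapping.single (\<Sum>x\<in>S. g x) 1 :: 'p::prime_card mpoly)"
  by (induction S rule: infinite_finite_induct) (simp_all add: mult_single)

lemma prime_card_gt_1: "CARD('p::prime_card) > 1"
  using prime_card[where 'a = 'p] by (rule prime_gt_1_nat)

lemma ext_const_of_int: "ext_const (of_int c) = (of_int c :: 'a::comm_ring_1 ext)"
proof -
  have "ext_const (of_nat m) = (of_nat m :: 'a ext)" for m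
    by (induction m) (simp_all add: ext_const_add)
  then show ?thesis
    by (cases c) (simp_all add: ext_const_uminus ext_const_diff del: of_nat_Suc)
qed

lemma bracket_expand:
  assumes "length rs = n"
  shows "ext_const (bracket rs) = (\<Sum>\<pi> | \<pi> permutes {0..<n}.
    cmon (of_int (sign \<pi>)) {||} (expo n (\<lambda>j. CARD('p) ^ (rs ! \<pi> (j - 1)))) :: 'p::prime_card cohom)"
proof -
  have *: "(\<Prod>a = 0..<n. xvar (a + 1) ^ (CARD('p) ^ (rs ! \<pi> a)))
      = (Poly_Mapping.single (expo n (\<lambda>j. CARD('p) ^ (rs ! \<pi> (j - 1)))) 1 :: 'p mpoly)" for \<pi>
  proof -
    have "(\<Sum>a = 0..<n. Poly_Mapping.single (a + 1) (CARD('p) ^ (rs ! \<pi> a)))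
        = expo n (\<lambda>j. CARD('p) ^ (rs ! \<pi> (j - 1)))"
      unfolding expo_def by (rule sum.reindex_bij_witness[of _ "\<lambda>j. j - 1" Suc]) auto
    then show ?thesis by (simp only: xvar_power prod_single)
  qed
  have "bracket rs = (\<Sum>\<pi> | \<pi> permutes {0..<n}. of_int (sign \<pi>) *
      (\<Prod>a = 0..<n. xvar (a + 1) ^ (CARD('p) ^ (rs ! \<pi> a))) :: 'p mpoly)"
    unfolding bracket_def assms
    by (subst det_def'[of _ n], simp, intro sum.cong refl arg_cong2[of _ _ _ _ "(*)"] prod.cong)
      (auto simp: permutes_in_image)
  then show ?thesis
    unfolding * by (simp add: ext_const_sum ext_const_mult ext_const_of_int cmon_const sign_cmon)
qed

text \<open>The order inspects \<open>x_1\<close> first, so small variables should take small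
  exponents. Once a permutation fixes all indices below \<open>a\<close>, only values from
  \<open>a\<close> on remain for \<open>a\<close>, and the identity picks the least of them.\<close>

lemma trailing_bracket:
  assumes n: "length rs = n" and sorted: "sorted_wrt (<) rs"
  shows "trailing (ext_const (bracket rs) :: 'p::prime_card cohom) {||}
    (expo n (\<lambda>j. CARD('p) ^ (rs ! (j - 1))))"
  unfolding bracket_expand[OF n]
proof (rule trailing_sum[where ?x0.0 = id])
  let ?p = "CARD('p)"
  have p: "?p > 1" by (rule prime_card_gt_1)
  show "finite {\<pi>. \<pi> permutes {0..<n}}" by (simp add: finite_permutations)
  show "id \<in> {\<pi>. \<pi> permutes {0..<n}}" by (simp add: permutes_id)
  show "trailing (cmon (of_int (sign id)) {||} (expo n (\<lambda>j. ?p ^ (rs ! id (j - 1)))) :: 'p cohom) {||}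
     (expo n (\<lambda>j. ?p ^ (rs ! (j - 1))))"
    using trailing_cmon[of 1] by simp
  have mono: "rs ! a < rs ! b" if "a < b" "b < n" for a b
    using that sorted n by (simp add: sorted_wrt_iff_nth_less)
  have inj: "a = b" if "rs ! a = rs ! b" "a < n" "b < n" for a b
    using that mono by (metis linorder_neqE_nat less_irrefl)
  fix \<pi> B s assume \<pi>: "\<pi> \<in> {\<pi>. \<pi> permutes {0..<n}}" "\<pi> \<noteq> id"
    and "(B, s) \<in> supp (cmon (of_int (sign \<pi>)) {||} (expo n (\<lambda>j. ?p ^ (rs ! \<pi> (j - 1)))) :: 'p cohom)"
  then have B: "B = {||}" and s: "s = expo n (\<lambda>j. ?p ^ (rs ! \<pi> (j - 1)))"
    by (auto simp: supp_cmon split: if_splits)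
  have perm: "\<pi> permutes {0..<n}" using \<pi> by simp
  have eq: "\<pi> a = a" if "Poly_Mapping.lookup (expo n (\<lambda>j. ?p ^ (rs ! (j - 1)))) (Suc a) = Poly_Mapping.lookup s (Suc a)" "a < n" for a
  proof -
    have "rs ! a = rs ! \<pi> a" using that p by (simp add: s lookup_expo)
    then show ?thesis using inj[of a "\<pi> a"] permutes_in_image[OF perm, of a] that by simp
  qed
  have "expo n (\<lambda>j. ?p ^ (rs ! (j - 1))) < s"
  proof (rule poly_mapping_lessI)
    show "expo n (\<lambda>j. ?p ^ (rs ! (j - 1))) \<noteq> s"
    proof
      assume "expo n (\<lambda>j. ?p ^ (rs ! (j - 1))) = s"
      then have "\<pi> a = a" for a
        using eq[of a] permutes_not_in[OF perm, of a] by (cases "a < n") auto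
      then show False using \<pi> by auto
    qed
    fix i assume *: "\<And>i'. i' < i \<Longrightarrow> Poly_Mapping.lookup (expo n (\<lambda>j. ?p ^ (rs ! (j - 1)))) i' = Poly_Mapping.lookup s i'"
    show "Poly_Mapping.lookup (expo n (\<lambda>j. ?p ^ (rs ! (j - 1)))) i \<le> Poly_Mapping.lookup s i"
    proof (cases "1 \<le> i \<and> i \<le> n")
      case True
      then obtain a where a: "i = Suc a" "a < n" by (cases i) auto
      have fix': "\<pi> a' = a'" if "a' < a" for a'
        using eq[of a'] *[of "Suc a'"] that a by simp
      have "a \<le> \<pi> a"
      proof (rule ccontr)
        assume "\<not> a \<le> \<pi> a"
        then have "\<pi> (\<pi> a) = \<pi> a" using fix' by simp
        then have "\<pi> a = a" using permutes_inj[OF perm] by (simp add: inj_eq)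
        with \<open>\<not> a \<le> \<pi> a\<close> show False by simp
      qed
      moreover have "\<pi> a < n" using permutes_in_image[OF perm, of a] a by simp
      ultimately have "rs ! a \<le> rs ! \<pi> a"
        using mono[of a "\<pi> a"] by (cases "a = \<pi> a") auto
      then show ?thesis using p a by (simp add: s lookup_expo power_increasing)
    qed (auto simp: lookup_expo)
  qed
  \<comment> \<open>With empty exterior part a weight is a doubled exponent, so the comparison of
    exponents is added to itself.\<close>
  then show "wt ?p {||} (expo n (\<lambda>j. ?p ^ (rs ! (j - 1)))) < wt ?p B s"
    unfolding B wt_def by (simp add: add_strict_mono)
qed

lemma homog_bracket:
  assumes n: "length rs = n"
  shows "homog n (2 * (\<Sum>a = 0..<n. CARD('p) ^ (rs ! a))) (ext_const (bracket rs) :: 'p::prime_card cohom)"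
  unfolding bracket_expand[OF n]
proof (rule homog_sum)
  fix \<pi> assume "\<pi> \<in> {\<pi>. \<pi> permutes {0..<n}}"
  then have perm: "\<pi> permutes {0..<n}" by simp
  have "(\<Sum>j = 1..n. CARD('p) ^ (rs ! \<pi> (j - 1))) = (\<Sum>a = 0..<n. CARD('p) ^ (rs ! \<pi> a))"
    by (rule sum.reindex_bij_witness[of _ Suc "\<lambda>j. j - 1"]) auto
  also have "\<dots> = (\<Sum>a = 0..<n. CARD('p) ^ (rs ! a))"
    using sum.permute[OF perm, of "\<lambda>a. CARD('p) ^ (rs ! a)"] by (simp add: o_def)
  finally show "homog n (2 * (\<Sum>a = 0..<n. CARD('p) ^ (rs ! a)))
    (cmon (of_int (sign \<pi>)) {||} (expo n (\<lambda>j. CARD('p) ^ (rs ! \<pi> (j - 1)))) :: 'p cohom)"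
    using keys_expo by (simp add: homog_def supp_cmon tdeg_expo)
qed

lemma filter_neq_upt: "i \<le> n \<Longrightarrow> filter (\<lambda>r. r \<noteq> i) [0..<n + 1] = [0..<i] @ [i + 1..<n + 1]"
proof -
  assume "i \<le> n"
  then have "[0..<n + 1] = [0..<i] @ [i] @ [i + 1..<n + 1]"
    by (metis append_Cons append_Nil less_Suc_eq_le Suc_eq_plus1 le_add_same_cancel1 less_imp_le
      upt_add_eq_append[of 0 i "n + 1 - i"] upt_conv_Cons le_add_diff_inverse le_SucI zero_le)
  moreover have "filter (\<lambda>r. r \<noteq> i) [0..<i] = [0..<i]" "filter (\<lambda>r. r \<noteq> i) [i + 1..<n + 1] = [i + 1..<n + 1]"
    by (auto simp: filter_id_conv)
  ultimately show ?thesis by simp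
qed

lemma omit_list:
  assumes "i \<le> n"
  shows "length (filter (\<lambda>r. r \<noteq> i) [0..<n + 1]) = n"
    and "j < n \<Longrightarrow> filter (\<lambda>r. r \<noteq> i) [0..<n + 1] ! j = (if j < i then j else j + 1)"
    and "sorted_wrt (<) (filter (\<lambda>r. r \<noteq> i) [0..<n + 1])"
  unfolding filter_neq_upt[OF assms] using assms
  by (auto simp: nth_append sorted_wrt_append)

lemma trailing_L_omit:
  assumes "i \<le> n"
  shows "trailing (ext_const (L_omit n i) :: 'p::prime_card cohom) {||}
    (expo n (\<lambda>j. CARD('p) ^ (if j \<le> i then j - 1 else j)))"
proof -
  let ?rs = "filter (\<lambda>r. r \<noteq> i) [0..<n + 1]"
  have "expo n (\<lambda>j. CARD('p) ^ (?rs ! (j - 1))) = expo n (\<lambda>j. CARD('p) ^ (if j \<le> i then j - 1 else j))"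
  proof (rule expo_cong, rule arg_cong[of _ _ "(^) CARD('p)"])
    fix j assume j: "1 \<le> j" "j \<le> n"
    then have "?rs ! (j - 1) = (if j - 1 < i then j - 1 else j - 1 + 1)"
      by (intro omit_list(2)[OF assms]) simp
    also have "\<dots> = (if j \<le> i then j - 1 else j)" using j by auto
    finally show "?rs ! (j - 1) = (if j \<le> i then j - 1 else j)" .
  qed
  then show ?thesis
    using trailing_bracket[OF omit_list(1,3)[OF assms], where 'p = 'p] unfolding L_omit_def by simp
qed

lemma trailing_L_poly:
  "trailing (ext_const (L_poly n) :: 'p::prime_card cohom) {||} (expo n (\<lambda>j. CARD('p) ^ (j - 1)))"
proof -
  have "expo n (\<lambda>j. CARD('p) ^ (if j \<le> n then j - 1 else j)) = expo n (\<lambda>j. CARD('p) ^ (j - 1))"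
    by (rule expo_cong) simp
  then show ?thesis using trailing_L_omit[of n n, where 'p = 'p] by (simp add: L_poly_def)
qed

lemma homog_L_omit: "i \<le> n \<Longrightarrow> \<exists>d. homog n d (ext_const (L_omit n i) :: 'p::prime_card cohom)"
  unfolding L_omit_def using homog_bracket[OF omit_list(1)] by blast

lemma L_poly_nonzero: "L_poly n \<noteq> (0 :: 'p::prime_card mpoly)"
  using trailing_supp[OF trailing_L_poly[of n, where 'p = 'p]] by (auto simp: supp_def)

section \<open>Dickson invariants as polynomials\<close>

lemma L_omit_det:
  assumes "i \<le> n"
  shows "L_omit n i = det (mat n n (\<lambda>(a, j). xvar (a + 1) ^ (CARD('p) ^ (if j < i then j else j + 1)) :: 'p::prime_card mpoly))"
  unfolding L_omit_def bracket_def omit_list(1)[OF assms]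
  using omit_list(2)[OF assms] by (intro arg_cong[of _ _ det] eq_matI) auto

text \<open>The Frobenius map is a ring homomorphism; applied to the entries of the matrix of
  \<open>L_n\<close> it turns the exponents \<open>0, ..., n - 1\<close> into
  \<open>1, ..., n\<close>.\<close>

lemma L_omit_zero: "L_omit n 0 = (L_poly n ^ CARD('p) :: 'p::prime_card mpoly)"
proof -
  let ?F = "\<lambda>y :: 'p mpoly. y ^ CARD('p)"
  interpret comm_ring_hom ?F
    using prime_card_gt_1[where 'p = 'p]
    by unfold_locales
      (auto simp: power_mult_distrib freshmans_dream CHAR_mpoly prime_card)
  have "L_omit n 0 = det (map_mat ?F (mat n n
      (\<lambda>(a, j). xvar (a + 1) ^ (CARD('p) ^ (if j < n then j else j + 1)))))"
    unfolding L_omit_det[OF le0]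
    by (intro arg_cong[of _ _ det] eq_matI) (auto simp: power_mult[symmetric] mult.commute)
  also have "\<dots> = L_poly n ^ CARD('p)"
    unfolding hom_det L_poly_def L_omit_det[OF order.refl] ..
  finally show ?thesis .
qed

text \<open>The polynomial that represents \<open>q_{n,i}\<close>. The sign combines the one in
  \<open>x^(p^n) = - (...)\<close>, obtained by solving \<open>f_n(x) = 0\<close>, with that of the
  cofactor at row \<open>i\<close> of the last column.\<close>

definition dickson_poly :: "nat \<Rightarrow> nat \<Rightarrow> 'p::prime_card mpoly" where
  "dickson_poly n i = - ((-1) ^ (i + (n - 1))) * dcoeff n i"

text \<open>Since \<open>f_n\<close> is monic and vanishes at every \<open>x_a\<close>, the column
  of exponent \<open>p^n\<close> is a combination of the columns of \<open>L_n\<close>. Thus the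
  matrix of \<open>L_{n,i}\<close> is that of \<open>L_n\<close> times a coefficient matrix, and
  determinants multiply.\<close>

lemma L_omit_dickson_poly:
  assumes "i < n"
  shows "L_omit n i = (L_poly n * dickson_poly n i :: 'p::prime_card mpoly)"
proof -
  let ?p = "CARD('p)"
  define r where "r j = (if j < i then j else j + 1)" for j
  define M where "M = mat n n (\<lambda>(a, l). xvar (a + 1) ^ (?p ^ l) :: 'p mpoly)"
  \<comment> \<open>All columns but the last select column \<open>r j\<close> of \<open>M\<close>,
    where \<open>r\<close> skips \<open>i\<close>; the last one holds the coefficients that express
    the exponent \<open>p^n\<close>.\<close>
  define C where "C = mat n n (\<lambda>(l, j). if j < n - 1 then (if l = r j then 1 else 0) else - dcoeff n l :: 'p mpoly)"
  have M: "M \<in> carrier_mat n n" and C: "C \<in> carrier_mat n n" by (simp_all add: M_def C_def)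
  have detM: "L_poly n = det M"
    unfolding L_poly_def L_omit_det[OF order.refl] M_def
    by (intro arg_cong[of _ _ det] eq_matI) auto
  have "L_omit n i = det (M * C)"
    unfolding L_omit_det[OF less_imp_le[OF assms]]
  proof (rule arg_cong[of _ _ det], rule eq_matI)
    fix a j assume "a < dim_row (M * C)" "j < dim_col (M * C)"
    then have a: "a < n" and j: "j < n" using M C by auto
    have "(M * C) $$ (a, j) = (\<Sum>l<n. xvar (a + 1) ^ (?p ^ l) * C $$ (l, j))"
      using M C a j by (simp add: scalar_prod_def M_def atLeast0LessThan)
    also have "\<dots> = xvar (a + 1) ^ (?p ^ r j)"
    proof (cases "j < n - 1")
      case True
      then have "r j < n" by (cases "j < i") (auto simp: r_def)
      have "(\<Sum>l<n. xvar (a + 1) ^ (?p ^ l) * C $$ (l, j)) = (\<Sum>l<n. if l = r j then xvar (a + 1) ^ (?p ^ l) else 0)"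
        using j True by (intro sum.cong) (auto simp: C_def)
      then show ?thesis using \<open>r j < n\<close> by simp
    next
      case False
      then have rj: "r j = n" using j assms by (auto simp: r_def)
      have "(\<Sum>l<n. xvar (a + 1) ^ (?p ^ l) * C $$ (l, j)) = - (\<Sum>l<n. dcoeff n l * xvar (a + 1) ^ (?p ^ l))"
        using j False unfolding sum_negf[symmetric] by (intro sum.cong) (auto simp: C_def)
      also have "\<dots> = xvar (a + 1) ^ (?p ^ n)"
        using dpoly_root[of "a + 1" n, where 'p = 'p] a
        by (simp add: dpoly_def lessThan_Suc_atMost[symmetric] dcoeff_diag add_eq_0_iff2)
      finally show ?thesis by (simp add: rj)
    qed
    finally show "mat n n (\<lambda>(a, j). xvar (a + 1) ^ (?p ^ (if j < i then j else j + 1))) $$ (a, j) = (M * C) $$ (a, j)"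
      using a j by (simp add: r_def)
  qed (use M C in auto)
  then have "L_omit n i = L_poly n * det C"
    by (simp add: det_mult[OF M C] detM)
  moreover have "det C = dickson_poly n i"
  proof -
    have n1: "n - 1 < n" using assms by simp
    have D: "mat_delete C l (n - 1) \<in> carrier_mat (n - 1) (n - 1)" for l
      by (rule mat_delete_carrier[OF C])
    have idx: "mat_delete C l (n - 1) $$ (l', j) = (if (if l' < l then l' else Suc l') = r j then 1 else 0)"
      if "l' < n - 1" "j < n - 1" for l l' j
      using that C by (auto simp: mat_delete_def C_def)
    \<comment> \<open>Row \<open>i\<close> of \<open>C\<close> is zero outside the last column
      because \<open>r\<close> never takes the value \<open>i\<close>. Deleting another row keeps
      it, and \<open>l'\<close> is its new position.\<close>
    have zero: "det (mat_delete C l (n - 1)) = 0" if "l \<noteq> i" "l < n" for l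
      unfolding det_def'[OF D]
    proof (rule sum.neutral, rule ballI)
      fix \<pi> assume "\<pi> \<in> {\<pi>. \<pi> permutes {0..<n - 1}}"
      then have \<pi>: "\<pi> permutes {0..<n - 1}" by simp
      define l' where "l' = (if i < l then i else i - 1)"
      have l': "l' < n - 1" using that assms by (auto simp: l'_def)
      have \<pi>l: "\<pi> l' < n - 1" using permutes_in_image[OF \<pi>, of l'] l' by simp
      have "(if l' < l then l' else Suc l') = i" using that by (auto simp: l'_def)
      then have "(if l' < l then l' else Suc l') \<noteq> r (\<pi> l')" by (simp add: r_def)
      then have "mat_delete C l (n - 1) $$ (l', \<pi> l') = 0" using idx[OF l' \<pi>l, of l] by simp
      then have "(\<Prod>a = 0..<n - 1. mat_delete C l (n - 1) $$ (a, \<pi> a)) = 0"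
        using l' by (intro prod_zero) auto
      then show "of_int (sign \<pi>) * (\<Prod>a = 0..<n - 1. mat_delete C l (n - 1) $$ (a, \<pi> a)) = 0" by simp
    qed
    have one: "mat_delete C i (n - 1) = 1\<^sub>m (n - 1)"
    proof (rule eq_matI)
      fix l' j assume "l' < dim_row (1\<^sub>m (n - 1))" "j < dim_col (1\<^sub>m (n - 1))"
      then have lj: "l' < n - 1" "j < n - 1" by auto
      show "mat_delete C i (n - 1) $$ (l', j) = 1\<^sub>m (n - 1) $$ (l', j)"
        using idx[OF lj] lj by (auto simp: r_def split: if_splits)
    qed (use D[of i] in auto)
    have "det C = (\<Sum>l<n. C $$ (l, n - 1) * cofactor C l (n - 1))"
      by (rule laplace_expansion_column[OF C n1])
    also have "\<dots> = (\<Sum>l<n. if l = i then - dcoeff n i * (-1) ^ (i + (n - 1)) else 0)"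
    proof (intro sum.cong refl)
      fix l assume l: "l \<in> {..<n}"
      have "C $$ (i, n - 1) = - dcoeff n i" using assms by (simp add: C_def)
      then show "C $$ (l, n - 1) * cofactor C l (n - 1) = (if l = i then - dcoeff n i * (-1) ^ (i + (n - 1)) else 0)"
        using l zero[of l] one by (auto simp: cofactor_def simp del: One_nat_def)
    qed
    also have "\<dots> = - dcoeff n i * (-1) ^ (i + (n - 1))" using assms by simp
    finally show ?thesis by (simp add: dickson_poly_def)
  qed
  ultimately show ?thesis by simp
qed

text \<open>The recursion for the coefficients does not display a trailing monomial. It is recovered
  by cancellation: the trailing exponents of \<open>L_n\<close> are subtracted from those of
  \<open>L_{n,i}\<close>, giving \<open>p^j - p^(j-1)\<close> for \<open>j > i\<close> and
  \<open>0\<close> otherwise.\<close>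

lemma trailing_dickson_poly:
  assumes "i < n"
  shows "trailing (ext_const (dickson_poly n i) :: 'p::prime_card cohom) {||}
    (expo n (\<lambda>j. if j \<le> i then 0 else CARD('p) ^ (j - 1) * (CARD('p) - 1)))"
proof -
  let ?p = "CARD('p)" and ?c = "ext_const (dickson_poly n i) :: 'p cohom"
  have omit: "trailing (ext_const (L_poly n) * ?c) {||} (expo n (\<lambda>j. ?p ^ (if j \<le> i then j - 1 else j)))"
    using trailing_L_omit[OF less_imp_le[OF assms], where 'p = 'p]
    by (simp add: L_omit_dickson_poly[OF assms] ext_const_mult)
  then have "?c \<noteq> 0" using trailing_supp by (fastforce simp: supp_def)
  then obtain A t where At: "trailing ?c A t" using trailing_exists by blast
  have A: "A = {||}" using trailing_supp[OF At] by (auto simp: supp_def cohom_coeff_const split: if_splits)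
  have "trailing (ext_const (L_poly n) * ?c) {||} (expo n (\<lambda>j. ?p ^ (j - 1)) + t)"
    using trailing_mult[OF trailing_L_poly At] A by simp
  with omit have eq: "expo n (\<lambda>j. ?p ^ (if j \<le> i then j - 1 else j)) = expo n (\<lambda>j. ?p ^ (j - 1)) + t"
    using trailing_unique by blast
  have "Poly_Mapping.lookup t j = Poly_Mapping.lookup (expo n (\<lambda>j. if j \<le> i then 0 else ?p ^ (j - 1) * (?p - 1))) j" for j
    using arg_cong[OF eq, of "\<lambda>u. Poly_Mapping.lookup u j"]
    by (cases j) (auto simp: lookup_expo lookup_add diff_mult_distrib2 mult.commute split: if_splits)
  then have "t = expo n (\<lambda>j. if j \<le> i then 0 else ?p ^ (j - 1) * (?p - 1))"
    by (rule poly_mapping_eqI)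
  then show ?thesis using At A by simp
qed

lemma homog_dickson_poly:
  assumes "i < n"
  shows "\<exists>d. homog n d (ext_const (dickson_poly n i) :: 'p::prime_card cohom)"
proof -
  have "dickson_poly n i = dcoeff n i \<or> dickson_poly n i = (- dcoeff n i :: 'p mpoly)"
    by (cases "even (i + (n - 1))") (simp_all add: dickson_poly_def del: even_add even_diff)
  then show ?thesis
    using homog_dcoeff[OF less_imp_le[OF assms], where 'p = 'p] homog_uminus
    by (metis ext_const_uminus)
qed

lemma dickson_eq:
  assumes "i < n"
  shows "dickson n i = Fract (dickson_poly n i :: 'p::prime_card mpoly) 1"
  using L_poly_nonzero[of n, where 'p = 'p]
  by (simp add: dickson_def L_omit_dickson_poly[OF assms] eq_fract mult.commute)

text \<open>As a power of \<open>L_n\<close>, the only invariant that may occur with a negative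
  exponent can be merged with the powers of \<open>L_n\<close> inside the
  \<open>R_{n;s}\<close>.\<close>

lemma dickson_zero_eq: "dickson n 0 = Fract (L_poly n ^ (CARD('p) - 1) :: 'p::prime_card mpoly) 1"
proof -
  have "(L_poly n :: 'p mpoly) ^ CARD('p) = L_poly n ^ (CARD('p) - 1) * L_poly n"
    using prime_card_gt_1[where 'p = 'p] by (intro power_minus_mult[symmetric]) simp
  then show ?thesis
    unfolding dickson_def L_omit_zero eq_fract(1)[OF L_poly_nonzero one_neq_zero] by simp
qed

text \<open>
  The exponents \<open>{0..<n} - {s}\<close> in increasing order, numbered by the rows \<open>2, \<dots>, n\<close> of the matrix of \<open>mui_M n s\<close>.
\<close>

definition mui_row :: "nat \<Rightarrow> nat \<Rightarrow> nat" where
  "mui_row s j = (if j - 2 < s then j - 2 else j - 1)"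

section \<open>Determinants with one exterior row\<close>

lemma cmon_gen_const:
  "ext_gen i * ext_const (Poly_Mapping.single t 1) = (cmon 1 {|i|} t :: 'p::prime_card cohom)"
proof -
  have "shuffle_sign {|i|} {||} = (1 :: 'p mpoly)" by (simp add: shuffle_sign_def)
  then show ?thesis by (simp add: ext_gen_def ext_const_def cmon_def times_ext_def conv_single)
qed

text \<open>Only the first row is exterior, so each term of the expansion has its single generator
  in front and reordering costs no sign.\<close>

lemma mui_M_expand:
  assumes "s < n"
  shows "mui_M n s = (\<Sum>\<pi> | \<pi> permutes {1..n}. cmon (of_int (sign \<pi>)) {|\<pi> 1|}
    (\<Sum>j = 2..n. Poly_Mapping.single (\<pi> j) (CARD('p) ^ mui_row s j)) :: 'p::prime_card cohom)"
  unfolding mui_M_def row_det_def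
proof (intro sum.cong refl)
  let ?p = "CARD('p)"
  let ?a = "\<lambda>j i. if j = 1 then ext_gen i
     else ext_const (xvar i ^ (?p ^ (filter (\<lambda>r. r \<noteq> s) [0..<n] ! (j - 2)))) :: 'p cohom"
  fix \<pi>
  have row: "filter (\<lambda>r. r \<noteq> s) [0..<n] ! (j - 2) = mui_row s j" if "2 \<le> j" "j \<le> n" for j
  proof -
    have n: "n - 1 + 1 = n" using assms by simp
    have "filter (\<lambda>r. r \<noteq> s) [0..<n - 1 + 1] ! (j - 2) = (if j - 2 < s then j - 2 else j - 2 + 1)"
      by (rule omit_list(2)) (use assms that in auto)
    then show ?thesis using that unfolding n mui_row_def by auto
  qed
  have "[1..<n + 1] = 1 # [2..<n + 1]"
    using assms by (simp add: upt_conv_Cons numeral_2_eq_2 del: upt_Suc)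
  then have "prod_list (map (\<lambda>j. ?a j (\<pi> j)) [1..<n + 1])
      = ext_gen (\<pi> 1) * prod_list (map (\<lambda>j. ?a j (\<pi> j)) [2..<n + 1])"
    by (simp del: upt_Suc)
  also have "map (\<lambda>j. ?a j (\<pi> j)) [2..<n + 1]
      = map ext_const (map (\<lambda>j. xvar (\<pi> j) ^ (?p ^ mui_row s j)) [2..<n + 1])"
    unfolding map_map by (rule map_cong) (auto simp: row)
  also have "prod_list \<dots> = ext_const (\<Prod>j\<in>set [2..<n + 1]. xvar (\<pi> j) ^ (?p ^ mui_row s j))"
    unfolding ext_const_prod_list[symmetric] by (subst prod.distinct_set_conv_list) simp_all
  also have "set [2..<n + 1] = {2..n}" by auto
  finally show "of_int (sign \<pi>) * prod_list (map (\<lambda>j. ?a j (\<pi> j)) [1..<n + 1])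
    = cmon (of_int (sign \<pi>)) {|\<pi> 1|} (\<Sum>j = 2..n. Poly_Mapping.single (\<pi> j) (?p ^ mui_row s j))"
    by (simp only: xvar_power prod_single cmon_gen_const sign_cmon mult_1_right)
qed

lemma lookup_permuted_sum:
  fixes \<pi> :: "nat \<Rightarrow> nat"
  assumes "\<pi> permutes {1..n}"
  shows "Poly_Mapping.lookup (\<Sum>j = 2..n. Poly_Mapping.single (\<pi> j) (f j)) i
    = (if Hilbert_Choice.inv \<pi> i \<in> {2..n} then f (Hilbert_Choice.inv \<pi> i) else 0)"
proof -
  have "\<pi> j = i \<longleftrightarrow> j = Hilbert_Choice.inv \<pi> i" for j
    using permutes_inv_eq[OF assms] by metis
  then show ?thesis by (simp add: lookup_sum lookup_single when_def)
qed

text \<open>Again a greedy choice, with variables picking rows in increasing order of index. The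
  variables up to \<open>x_s\<close> take the exponents \<open>p^0, ..., p^(s-1)\<close>; at
  \<open>s + 1\<close> the exponent \<open>p^s\<close> is missing and the exterior row is the
  cheapest; the later variables take the rows that are left in order.\<close>

lemma trailing_mui_M:
  assumes s: "s < n"
  shows "trailing (mui_M n s :: 'p::prime_card cohom) {|s + 1|}
    (expo n (\<lambda>j. if j = s + 1 then 0 else CARD('p) ^ (j - 1)))"
  unfolding mui_M_expand[OF s]
proof -
  let ?p = "CARD('p)"
  have p: "?p > 1" by (rule prime_card_gt_1)
  define \<tau> where "\<tau> \<pi> = (\<Sum>j = 2..n. Poly_Mapping.single (\<pi> j) (?p ^ mui_row s j))" for \<pi> :: "nat \<Rightarrow> nat"
  \<comment> \<open>Permutations send rows to variables. The optimal one is a cycle that gives the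
    exterior row to variable \<open>s + 1\<close> and moves rows \<open>2, ..., s + 1\<close> down
    by one; its inverse \<open>\<sigma>0\<close> names the row used by each variable.\<close>
  define \<pi>0 where "\<pi>0 j = (if j = 1 then s + 1 else if 2 \<le> j \<and> j \<le> s + 1 then j - 1 else j)" for j
  define \<sigma>0 where "\<sigma>0 i = (if i = 0 then 0 else if i \<le> s then i + 1 else if i = s + 1 then 1 else i)" for i
  \<comment> \<open>\<open>G i j\<close> is the weight at position \<open>i\<close> when variable
    \<open>i\<close> receives row \<open>j\<close>; it is \<open>0\<close> for \<open>j\<close>
    outside the range.\<close>
  define G where "G i j = 2 * (if j \<in> {2..n} then ?p ^ mui_row s j else 0)
      + (if j = 1 then 2 * ?p ^ (i - 1) + 1 else 0)" for i j
  have inv1: "\<pi>0 (\<sigma>0 i) = i" "\<sigma>0 (\<pi>0 i) = i" for i by (auto simp: \<pi>0_def \<sigma>0_def)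
  have bij: "bij_betw \<pi>0 {1..n} {1..n}"
    by (rule bij_betw_byWitness[where f' = \<sigma>0]) (use s inv1 in \<open>auto simp: \<pi>0_def \<sigma>0_def\<close>)
  have \<pi>0: "\<pi>0 permutes {1..n}"
    by (rule bij_imp_permutes[OF bij]) (use s in \<open>auto simp: \<pi>0_def\<close>)
  have inv\<pi>0: "Hilbert_Choice.inv \<pi>0 = \<sigma>0"
    by (rule inv_unique_comp) (auto simp: inv1)
  have wt: "Poly_Mapping.lookup (wt ?p {|\<pi> 1|} (\<tau> \<pi>)) i = G i (Hilbert_Choice.inv \<pi> i)" if "\<pi> permutes {1..n}" for \<pi> i
  proof -
    have "i |\<in>| {|\<pi> 1|} \<longleftrightarrow> Hilbert_Choice.inv \<pi> i = 1" using permutes_inv_eq[OF that, of i 1] by auto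
    then show ?thesis unfolding lookup_wt \<tau>_def lookup_permuted_sum[OF that] G_def by simp
  qed
  \<comment> \<open>Parity separates the exterior row from the others, and those have distinct
    exponents. So equal weights at a position mean equal rows.\<close>
  have Ginj: "j = j'" if "G i j = G i j'" "j \<in> {1..n}" "j' \<in> {1..n}" for i j j'
  proof -
    have odd: "odd (G i j) \<longleftrightarrow> j = 1" for j by (simp add: G_def)
    show ?thesis
    proof (cases "j = 1 \<or> j' = 1")
      case False
      then have "mui_row s j = mui_row s j'" using that p by (auto simp: G_def)
      with False that show ?thesis by (auto simp: mui_row_def split: if_splits)
    qed (use odd[of j] odd[of j'] that(1) in metis)
  qed
  have less: "wt ?p {|\<pi>0 1|} (\<tau> \<pi>0) < wt ?p {|\<pi> 1|} (\<tau> \<pi>)" if \<pi>: "\<pi> permutes {1..n}" "\<pi> \<noteq> \<pi>0" for \<pi>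
  proof -
    let ?\<sigma> = "Hilbert_Choice.inv \<pi>"
    have \<sigma>: "?\<sigma> permutes {1..n}" using permutes_inv[OF \<pi>(1)] .
    have \<sigma>0: "\<sigma>0 permutes {1..n}" using permutes_inv[OF \<pi>0] inv\<pi>0 by simp
    have agree: "?\<sigma> i = \<sigma>0 i"
      if "Poly_Mapping.lookup (wt ?p {|\<pi>0 1|} (\<tau> \<pi>0)) i = Poly_Mapping.lookup (wt ?p {|\<pi> 1|} (\<tau> \<pi>)) i" for i
    proof (cases "i \<in> {1..n}")
      case True
      then show ?thesis
        using that Ginj[of i "?\<sigma> i" "\<sigma>0 i"] permutes_in_image[OF \<sigma>, of i] permutes_in_image[OF \<sigma>0, of i]
        unfolding wt[OF \<pi>(1)] wt[OF \<pi>0] inv\<pi>0 by simp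
    next
      case False
      then show ?thesis using permutes_not_in[OF \<sigma>] permutes_not_in[OF \<sigma>0] by simp
    qed
    show ?thesis
    proof (rule poly_mapping_lessI)
      show "wt ?p {|\<pi>0 1|} (\<tau> \<pi>0) \<noteq> wt ?p {|\<pi> 1|} (\<tau> \<pi>)"
      proof
        assume "wt ?p {|\<pi>0 1|} (\<tau> \<pi>0) = wt ?p {|\<pi> 1|} (\<tau> \<pi>)"
        then have "?\<sigma> = Hilbert_Choice.inv \<pi>0" using agree inv\<pi>0 by auto
        then have "\<pi> = \<pi>0" using permutes_inv_inv[OF \<pi>(1)] permutes_inv_inv[OF \<pi>0] by metis
        with \<pi>(2) show False by simp
      qed
      fix i assume *: "\<And>i'. i' < i \<Longrightarrow> Poly_Mapping.lookup (wt ?p {|\<pi>0 1|} (\<tau> \<pi>0)) i'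
        = Poly_Mapping.lookup (wt ?p {|\<pi> 1|} (\<tau> \<pi>)) i'"
      \<comment> \<open>As long as the weights agree, the rows used by the optimal choice for
        smaller variables are no longer available.\<close>
      have N: "?\<sigma> i \<noteq> \<sigma>0 i'" if "i' < i" for i'
        using agree[OF *[OF that]] that permutes_inj[OF \<sigma>] by (metis injD less_irrefl)
      have "G i (\<sigma>0 i) \<le> G i (?\<sigma> i)"
      proof (cases "i \<in> {1..n}")
        case False
        then show ?thesis using permutes_not_in[OF \<sigma>] permutes_not_in[OF \<sigma>0] by simp
      next
        case True
        then have j: "?\<sigma> i \<in> {1..n}" using permutes_in_image[OF \<sigma>, of i] by simp
        consider "i \<le> s" | "i = s + 1" | "i > s + 1" by linarith
        then show ?thesis
        proof cases
          case 1
          then have G0: "G i (\<sigma>0 i) = 2 * ?p ^ (i - 1)"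
            using True s by (auto simp: G_def \<sigma>0_def mui_row_def)
          \<comment> \<open>Rows \<open>2\<close> to \<open>i\<close> belong to the variables
            \<open>1\<close> to \<open>i - 1\<close>.\<close>
          have "\<not> (2 \<le> ?\<sigma> i \<and> ?\<sigma> i \<le> i)"
          proof
            assume A: "2 \<le> ?\<sigma> i \<and> ?\<sigma> i \<le> i"
            then have "\<pi>0 (?\<sigma> i) = ?\<sigma> i - 1" using 1 by (simp add: \<pi>0_def)
            moreover have "?\<sigma> i - 1 < i" using A 1 by linarith
            ultimately have "\<pi>0 (?\<sigma> i) < i" by simp
            from N[OF this] show False by (simp add: inv1)
          qed
          \<comment> \<open>Left are the exterior row, which exceeds the optimal weight by one, and
            rows of exponent at least \<open>p^(i-1)\<close>.\<close>
          then consider "?\<sigma> i = 1" | "?\<sigma> i \<ge> i + 1" "?\<sigma> i \<ge> 2" using j by force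
          then show ?thesis
          proof cases
            case 2
            then have "i - 1 \<le> mui_row s (?\<sigma> i)" by (auto simp: mui_row_def)
            then show ?thesis unfolding G0 using 2 j p by (simp add: G_def power_increasing)
          qed (simp only: G0, simp add: G_def)
        next
          case 2
          \<comment> \<open>Every polynomial row still available has exponent at least
            \<open>p^(s+1)\<close>, above the weight of the generator.\<close>
          then have G0: "G i (\<sigma>0 i) = 2 * ?p ^ s + 1"
            by (auto simp: G_def \<sigma>0_def)
          have "\<not> (2 \<le> ?\<sigma> i \<and> ?\<sigma> i \<le> s + 1)"
          proof
            assume A: "2 \<le> ?\<sigma> i \<and> ?\<sigma> i \<le> s + 1"
            then have "\<pi>0 (?\<sigma> i) = ?\<sigma> i - 1" using 2 by (simp add: \<pi>0_def)
            moreover have "?\<sigma> i - 1 < i" using A 2 by linarith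
            ultimately have "\<pi>0 (?\<sigma> i) < i" by simp
            from N[OF this] show False by (simp add: inv1)
          qed
          then consider "?\<sigma> i = 1" | "?\<sigma> i \<ge> s + 2" using j by force
          then show ?thesis
          proof cases
            case 1
            then show ?thesis unfolding G0 using 2 by (simp add: G_def)
          next
            case 2
            then have "s < mui_row s (?\<sigma> i)" by (auto simp: mui_row_def)
            then have "?p ^ s < ?p ^ mui_row s (?\<sigma> i)" using p by (rule power_strict_increasing)
            then show ?thesis unfolding G0 using 2 j by (simp add: G_def)
          qed
        next
          case 3
          then have G0: "G i (\<sigma>0 i) = 2 * ?p ^ (i - 1)"
            using True by (auto simp: G_def \<sigma>0_def mui_row_def)
          have "i \<le> ?\<sigma> i"
          proof (rule ccontr)
            assume "\<not> i \<le> ?\<sigma> i"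
            then have "\<pi>0 (?\<sigma> i) < i" using 3 j by (auto simp: \<pi>0_def)
            from N[OF this] show False by (simp add: inv1)
          qed
          then have "i - 1 \<le> mui_row s (?\<sigma> i)" "2 \<le> ?\<sigma> i" using 3 by (auto simp: mui_row_def)
          then show ?thesis unfolding G0 using j p by (simp add: G_def power_increasing)
        qed
      qed
      then show "Poly_Mapping.lookup (wt ?p {|\<pi>0 1|} (\<tau> \<pi>0)) i
          \<le> Poly_Mapping.lookup (wt ?p {|\<pi> 1|} (\<tau> \<pi>)) i"
        unfolding wt[OF \<pi>(1)] wt[OF \<pi>0] inv\<pi>0 .
    qed
  qed
  have \<tau>0: "\<tau> \<pi>0 = expo n (\<lambda>j. if j = s + 1 then 0 else ?p ^ (j - 1))"
  proof (rule poly_mapping_eqI)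
    fix i
    show "Poly_Mapping.lookup (\<tau> \<pi>0) i
        = Poly_Mapping.lookup (expo n (\<lambda>j. if j = s + 1 then 0 else ?p ^ (j - 1))) i"
      unfolding \<tau>_def lookup_permuted_sum[OF \<pi>0] inv\<pi>0 lookup_expo
      using s by (auto simp: \<sigma>0_def mui_row_def)
  qed
  have \<pi>01: "\<pi>0 1 = s + 1" by (simp add: \<pi>0_def)
  have "trailing (\<Sum>\<pi> | \<pi> permutes {1..n}. cmon (of_int (sign \<pi>)) {|\<pi> 1|} (\<tau> \<pi>) :: 'p cohom)
    {|\<pi>0 1|} (\<tau> \<pi>0)"
  proof (rule trailing_sum[where ?x0.0 = \<pi>0])
    fix \<pi> B t assume "\<pi> \<in> {\<pi>. \<pi> permutes {1..n}}" "\<pi> \<noteq> \<pi>0"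
      and "(B, t) \<in> supp (cmon (of_int (sign \<pi>)) {|\<pi> 1|} (\<tau> \<pi>) :: 'p cohom)"
    then show "wt ?p {|\<pi>0 1|} (\<tau> \<pi>0) < wt ?p B t"
      using less[of \<pi>] by (auto simp: supp_cmon split: if_splits)
  qed (use \<pi>0 in \<open>auto simp: finite_permutations trailing_cmon of_int_sign_neq_0\<close>)
  then show "trailing (\<Sum>\<pi> | \<pi> permutes {1..n}. cmon (of_int (sign \<pi>)) {|\<pi> 1|}
    (\<Sum>j = 2..n. Poly_Mapping.single (\<pi> j) (?p ^ mui_row s j)) :: 'p cohom) {|s + 1|}
    (expo n (\<lambda>j. if j = s + 1 then 0 else ?p ^ (j - 1)))"
    unfolding \<tau>0 \<pi>01 unfolding \<tau>_def .
qed

lemma homog_mui_M: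
  assumes s: "s < n"
  shows "homog n (1 + 2 * (\<Sum>j = 2..n. CARD('p) ^ mui_row s j)) (mui_M n s :: 'p::prime_card cohom)"
  unfolding mui_M_expand[OF s]
proof (rule homog_sum)
  fix \<pi> assume "\<pi> \<in> {\<pi>. \<pi> permutes {1..n}}"
  then have \<pi>: "\<pi> permutes {1..n}" by simp
  let ?t = "\<Sum>j = 2..n. Poly_Mapping.single (\<pi> j) (CARD('p) ^ mui_row s j)"
  have tdeg_sum: "tdeg (\<Sum>j\<in>S. g j) = (\<Sum>j\<in>S. tdeg (g j))" for g and S :: "nat set"
    by (induction S rule: infinite_finite_induct) (simp_all add: tdeg_add)
  have "i \<in> {1..n}" if "i \<in> Poly_Mapping.keys ?t" for i
  proof (rule ccontr)
    assume "i \<notin> {1..n}"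
    then have "Hilbert_Choice.inv \<pi> i \<notin> {2..n}" using permutes_not_in[OF permutes_inv[OF \<pi>], of i] by auto
    then have "Poly_Mapping.lookup ?t i = 0"
      unfolding lookup_permuted_sum[OF \<pi>] by (simp only: if_False)
    with that show False by (simp only: in_keys_iff)
  qed
  then have "Poly_Mapping.keys ?t \<subseteq> {1..n}" by blast
  moreover have "\<pi> 1 \<in> {1..n}" using permutes_in_image[OF \<pi>, of 1] s by simp
  moreover have "fcard {|\<pi> 1|} = 1" by (simp add: fcard.rep_eq)
  ultimately show "homog n (1 + 2 * (\<Sum>j = 2..n. CARD('p) ^ mui_row s j))
     (cmon (of_int (sign \<pi>)) {|\<pi> 1|} ?t :: 'p cohom)"
    by (simp add: homog_def supp_cmon tdeg_sum)
qed

section \<open>The monomials as elements of the cohomology\<close>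

lemma ext_coeff_to_loc: "ext_coeff (to_loc y) A = to_fract (ext_coeff y A)"
  by (simp add: to_loc_def map_coeffs_def ext_coeff_def Poly_Mapping.map.rep_eq when_def flip: to_fract_def)

lemma to_loc_inject: "to_loc x = to_loc y \<Longrightarrow> x = y"
  by (rule ext_eqI) (metis ext_coeff_to_loc to_fract_eq_iff)

lemma to_fract_prod: "to_fract (prod f S) = (\<Prod>x\<in>S. to_fract (f x))"
  by (induction S rule: infinite_finite_induct) simp_all

lemma to_fract_power: "to_fract (u ^ m) = to_fract u ^ m"
  by (induction m) simp_all

lemma to_loc_mult: "to_loc (x * y) = to_loc x * to_loc (y :: 'p::prime_card cohom)"
proof (rule ext_eqI)
  fix C
  have keys: "Poly_Mapping.keys (ext_coeffs (to_loc z)) = Poly_Mapping.keys (ext_coeffs z)" for z :: "'p cohom"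
  proof -
    have "Poly_Mapping.lookup (ext_coeffs (to_loc z)) A = 0 \<longleftrightarrow> Poly_Mapping.lookup (ext_coeffs z) A = 0" for A
      using ext_coeff_to_loc[of z A] by (simp add: ext_coeff_def)
    then show ?thesis unfolding set_eq_iff in_keys_iff by blast
  qed
  have "to_fract (shuffle_sign A B :: 'p mpoly) = shuffle_sign A B" for A B
    by (simp add: shuffle_sign_def minus_one_power_iff to_fract_uminus)
  then show "ext_coeff (to_loc (x * y)) C = ext_coeff (to_loc x * to_loc y) C"
    unfolding ext_coeff_to_loc ext_coeff_mult keys to_fract_sum
    by (intro sum.cong refl) (simp add: when_def ext_coeff_to_loc)
qed

lemma to_loc_const: "to_loc (ext_const u) = ext_const (to_fract u)"
  by (rule ext_eqI) (simp add: ext_coeff_to_loc ext_coeff_const)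

lemma to_loc_one: "to_loc 1 = 1"
  using to_loc_const[of 1] by simp

lemma to_loc_power: "to_loc (x ^ m) = to_loc x ^ m"
  by (induction m) (simp_all add: to_loc_one to_loc_mult)

lemma to_loc_prod_list: "to_loc (prod_list xs) = prod_list (map to_loc xs)"
  by (induction xs) (simp_all add: to_loc_one to_loc_mult)

lemma mult_const_power: "(x * ext_const c) ^ m = x ^ m * ext_const (c ^ m)"
proof (induction m)
  case (Suc m)
  have "(x * ext_const c) ^ Suc m = x * (ext_const c * x ^ m) * ext_const (c ^ m)"
    by (simp add: Suc.IH mult.assoc)
  then show ?case by (simp add: ext_const_central[of c] ext_const_mult mult.assoc)
qed simp

text \<open>Coefficients are central, so they can be collected on the right while the noncommuting
  factors keep their order.\<close>

lemma prod_list_mult_const: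
  "prod_list (map (\<lambda>s. f s * ext_const (g s)) xs)
     = prod_list (map f xs) * ext_const (prod_list (map g xs))"
proof (induction xs)
  case (Cons s xs)
  have "prod_list (map (\<lambda>s. f s * ext_const (g s)) (s # xs))
      = f s * (ext_const (g s) * prod_list (map f xs)) * ext_const (prod_list (map g xs))"
    by (simp add: Cons.IH mult.assoc)
  then show ?case by (simp add: ext_const_central[of "g s"] ext_const_mult mult.assoc)
qed simp

text \<open>
  Since \<open>q\<^sub>n\<^sub>,\<^sub>0\<close> is \<open>L\<^sub>n\<close> raised to \<open>p - 1\<close> and each \<open>R\<^sub>n\<^sub>;\<^sub>s\<close> contains \<open>L\<^sub>n\<close> raised to \<open>p - 2\<close>, the total exponent
  of \<open>L\<^sub>n\<close> in \<open>q\<^sup>I\<close> is \<open>(p - 2) b(I) + (p - 1) i\<^sub>1\<close>. It is nonnegative for \<open>2 i\<^sub>1 + b(I) \<ge> 0\<close> and \<open>p \<ge> 3\<close>, so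
  no divisibility of products of the \<open>M\<^sub>n\<^sub>;\<^sub>s\<close> is needed.
\<close>

definition L_exp :: "nat \<Rightarrow> nat \<Rightarrow> index \<Rightarrow> int" where
  "L_exp p n = (\<lambda>(\<epsilon>, i). int (p - 2) * int (b_sum n \<epsilon>) + int (p - 1) * i 1)"

text \<open>The collected polynomial factor of \<open>q^I\<close>. The product starts at
  \<open>2\<close> because \<open>q_{n,0}\<close> is absorbed in the power of \<open>L_n\<close>. On
  \<open>indices\<close>, with \<open>p\<close> at least 3, no \<open>nat\<close> truncates.\<close>

definition qscal :: "nat \<Rightarrow> index \<Rightarrow> 'p::prime_card mpoly" where
  "qscal n I = L_poly n ^ nat (L_exp CARD('p) n I) *
     (\<Prod>s = 2..n. dickson_poly n (s - 1) ^ nat (snd I s))"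

definition qpoly :: "nat \<Rightarrow> index \<Rightarrow> 'p::prime_card cohom" where
  "qpoly n I = prod_list (map (\<lambda>s. mui_M n (s - 1) ^ fst I s) [1..<n + 1]) * ext_const (qscal n I)"

text \<open>Twice the exponent is \<open>(p - 1) (2 i_1 + b) + (p - 3) b\<close>, where both
  summands are nonnegative; this is where an odd prime enters.\<close>

lemma L_exp_nonneg:
  assumes "I \<in> indices n k" and "3 \<le> p"
  shows "0 \<le> L_exp p n I"
proof -
  obtain \<epsilon> i where I: "I = (\<epsilon>, i)" by (cases I)
  let ?b = "int (b_sum n \<epsilon>)"
  have "0 \<le> 2 * i 1 + ?b" using assms(1) by (auto simp: I indices_def)
  then have "0 \<le> int (p - 1) * (2 * i 1 + ?b)" by simp
  also have "\<dots> = 2 * L_exp p n I - int (p - 3) * ?b"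
    using assms(2) by (simp add: I L_exp_def of_nat_diff algebra_simps)
  finally show ?thesis using mult_nonneg_nonneg[of "int (p - 3)" ?b] by linarith
qed

lemma to_loc_qpoly:
  assumes I: "I \<in> indices n k" and p: "3 \<le> CARD('p)" and n: "1 \<le> n"
  shows "to_loc (qpoly n I :: 'p::prime_card cohom) = qmon_loc n I"
proof -
  let ?p = "CARD('p)"
  obtain \<epsilon> i where I': "I = (\<epsilon>, i)" by (cases I)
  define l where "l = to_fract (L_poly n :: 'p mpoly)"
  have l: "l \<noteq> 0" using L_poly_nonzero[of n, where 'p = 'p] by (simp add: l_def)
  let ?D = "\<lambda>s. dickson n (s - 1) powi i s :: 'p mpoly fract"
  have "qmon_loc n I = prod_list (map (\<lambda>s. to_loc (mui_M n (s - 1) ^ \<epsilon> s :: 'p cohom) *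
      ext_const ((l ^ (?p - 2)) ^ \<epsilon> s * ?D s)) [1..<n + 1])"
    by (simp add: qmon_loc_def I' mui_R_def to_loc_mult to_loc_const to_loc_power mult_const_power
        ext_const_mult l_def to_fract_power mult.assoc)
  also have "\<dots> = to_loc (prod_list (map (\<lambda>s. mui_M n (s - 1) ^ \<epsilon> s) [1..<n + 1])) *
      ext_const (prod_list (map (\<lambda>s. (l ^ (?p - 2)) ^ \<epsilon> s * ?D s) [1..<n + 1]))"
    by (simp only: prod_list_mult_const to_loc_prod_list map_map o_def)
  also have "prod_list (map (\<lambda>s. (l ^ (?p - 2)) ^ \<epsilon> s * ?D s) [1..<n + 1])
      = (\<Prod>s\<in>set [1..<n + 1]. (l ^ (?p - 2)) ^ \<epsilon> s * ?D s)"
    by (rule prod.distinct_set_conv_list[symmetric]) simp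
  also have "set [1..<n + 1] = {1..n}" by auto
  also have "(\<Prod>s\<in>{1..n}. (l ^ (?p - 2)) ^ \<epsilon> s * ?D s)
      = (l ^ (?p - 2)) ^ b_sum n \<epsilon> * (\<Prod>s = 1..n. ?D s)"
    by (simp add: prod.distrib b_sum_def power_sum)
  also have "(\<Prod>s = 1..n. ?D s) = ?D 1 * (\<Prod>s = 2..n. ?D s)"
    using n by (simp add: prod.atLeast_Suc_atMost numeral_2_eq_2)
  \<comment> \<open>The only factor with a possibly negative exponent; it is combined with the other
    powers of \<open>L_n\<close> in the field of fractions before returning to polynomials.\<close>
  also have "?D 1 = l powi (int (?p - 1) * i 1)"
  proof -
    have "(l ^ (?p - 1)) powi i 1 = l powi (int (?p - 1) * i 1)"
      unfolding power_int_mult power_int_of_nat ..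
    then show ?thesis
      by (simp add: dickson_zero_eq to_fract_def[symmetric] to_fract_power l_def)
  qed
  also have "(l ^ (?p - 2)) ^ b_sum n \<epsilon> = l powi (int (?p - 2) * int (b_sum n \<epsilon>))"
    by (simp add: power_mult[symmetric] flip: of_nat_mult)
  also have "l powi (int (?p - 2) * int (b_sum n \<epsilon>)) * (l powi (int (?p - 1) * i 1) * (\<Prod>s = 2..n. ?D s))
      = l powi L_exp ?p n I * (\<Prod>s = 2..n. ?D s)"
    using l by (simp add: L_exp_def I' power_int_add)
  also have "l powi L_exp ?p n I = l ^ nat (L_exp ?p n I)"
    using L_exp_nonneg[OF I p] by (simp add: power_int_def)
  also have "(\<Prod>s = 2..n. ?D s) = (\<Prod>s = 2..n. to_fract (dickson_poly n (s - 1)) ^ nat (i s))"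
  proof (intro prod.cong refl)
    fix s assume s: "s \<in> {2..n}"
    then have "0 \<le> i s" using I by (auto simp: I' indices_def)
    moreover have "s - 1 < n" using s by auto
    ultimately show "?D s = to_fract (dickson_poly n (s - 1)) ^ nat (i s)"
      by (simp add: dickson_eq to_fract_def[symmetric] power_int_def)
  qed
  also have "l ^ nat (L_exp ?p n I) * \<dots> = to_fract (qscal n I)"
    by (simp add: qscal_def I' l_def to_fract_power to_fract_prod)
  finally show ?thesis
    by (simp add: qpoly_def I' to_loc_mult to_loc_const)
qed

lemma homog_prod_list:
  "(\<And>x. x \<in> set xs \<Longrightarrow> \<exists>d. homog n d x) \<Longrightarrow> \<exists>d. homog n d (prod_list xs)"
proof (induction xs)
  case (Cons x xs)
  then show ?case using homog_mult by (metis list.set_intros prod_list.Cons)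
qed (auto intro: homog_one)

lemma homog_const_prod:
  "(\<And>s. s \<in> S \<Longrightarrow> \<exists>d. homog n d (ext_const (f s))) \<Longrightarrow> \<exists>d. homog n d (ext_const (\<Prod>s\<in>S. f s ^ k s))"
proof (induction S rule: infinite_finite_induct)
  case (insert s S)
  obtain d where "homog n d (ext_const (f s))" using insert.prems by blast
  moreover obtain e where "homog n e (ext_const (\<Prod>s\<in>S. f s ^ k s))"
    using insert.IH insert.prems by blast
  ultimately have "homog n (k s * d + e) (ext_const (f s) ^ k s * ext_const (\<Prod>s\<in>S. f s ^ k s))"
    by (intro homog_mult homog_power)
  then show ?case
    using insert.hyps by (auto simp: ext_const_mult ext_const_power)
qed (auto intro: homog_one)

lemma homog_L_poly: "\<exists>d. homog n d (ext_const (L_poly n) :: 'p::prime_card cohom)"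
  unfolding L_poly_def by (rule homog_L_omit) simp

text \<open>The degree may stay unspecified: it can be read off any nonzero coefficient, in
  particular the trailing one.\<close>

lemma homog_qpoly: "\<exists>d. homog n d (qpoly n I :: 'p::prime_card cohom)"
proof -
  have "\<exists>d. homog n d (prod_list (map (\<lambda>s. mui_M n (s - 1) ^ fst I s) [1..<n + 1]) :: 'p cohom)"
  proof (rule homog_prod_list)
    fix x :: "'p cohom" assume "x \<in> set (map (\<lambda>s. mui_M n (s - 1) ^ fst I s) [1..<n + 1])"
    then obtain s where "1 \<le> s" "s < n + 1" "x = mui_M n (s - 1) ^ fst I s" by auto
    moreover from this have "s - 1 < n" by simp
    ultimately show "\<exists>d. homog n d x"
      using homog_power[OF homog_mui_M] by blast
  qed
  moreover have "\<exists>d. homog n d (ext_const (\<Prod>s = 2..n. dickson_poly n (s - 1) ^ nat (snd I s)) :: 'p cohom)"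
    by (rule homog_const_prod, rule homog_dickson_poly) auto
  moreover have "\<exists>d. homog n d (ext_const (L_poly n ^ nat (L_exp CARD('p) n I)) :: 'p cohom)"
    using homog_L_poly homog_power unfolding ext_const_power by blast
  ultimately show ?thesis
    unfolding qpoly_def qscal_def ext_const_mult by (blast intro: homog_mult)
qed

text \<open>Injectivity of \<open>to_loc\<close> makes the description by \<open>THE\<close> unique,
  and \<open>qpoly\<close> witnesses existence.\<close>

lemma qmon_eq_qpoly:
  assumes "I \<in> indices n k" "3 \<le> CARD('p)" "1 \<le> n"
  shows "qmon n I = (qpoly n I :: 'p::prime_card cohom)"
  unfolding qmon_def
proof (rule the_equality)
  show "qpoly n I \<in> cohomology n \<and> to_loc (qpoly n I :: 'p cohom) = qmon_loc n I"
    using homog_qpoly[of n I] to_loc_qpoly[OF assms] by (auto simp: homog_iff)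
  show "y = qpoly n I" if "y \<in> cohomology n \<and> to_loc y = qmon_loc n I" for y :: "'p cohom"
    using that to_loc_qpoly[OF assms] by (metis to_loc_inject)
qed

section \<open>The dual monomials\<close>

definition odd_part :: "nat \<Rightarrow> (nat \<Rightarrow> nat) \<Rightarrow> nat fset" where
  "odd_part n \<epsilon> = fset_of_list (filter (\<lambda>s. \<epsilon> s = 1) [1..<n + 1])"

lemma odd_part_iff: "s |\<in>| odd_part n \<epsilon> \<longleftrightarrow> 1 \<le> s \<and> s \<le> n \<and> \<epsilon> s = 1"
  by (auto simp: odd_part_def fset_of_list_elem)

definition even_part :: "nat \<Rightarrow> nat \<Rightarrow> index \<Rightarrow> (nat \<Rightarrow>\<^sub>0 nat)" where
  "even_part p n = (\<lambda>(\<epsilon>, i). expo n (\<lambda>s. nat (int p ^ (s - 1) * (int p - 1) *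
     ((\<Sum>j = 1..s. i j) + int (b_sum n \<epsilon>)) - int p ^ (s - 1) * int (\<epsilon> s))))"

text \<open>The induction runs over the number \<open>m\<close> of factors with the number
  \<open>n\<close> of variables fixed. The factor \<open>mui_M n (s - 1)\<close> brings the
  generator \<open>e_s\<close>, a new one each time, so exterior parts stay disjoint.\<close>

lemma trailing_M_prod:
  assumes "\<And>s. 1 \<le> s \<Longrightarrow> s \<le> n \<Longrightarrow> \<epsilon> s \<in> {0, 1}" and "m \<le> n"
  shows "trailing (prod_list (map (\<lambda>s. mui_M n (s - 1) ^ \<epsilon> s) [1..<m + 1]) :: 'p::prime_card cohom)
    (odd_part m \<epsilon>) (expo n (\<lambda>j. \<Sum>s = 1..m. \<epsilon> s * (if j = s then 0 else CARD('p) ^ (j - 1))))"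
  using assms(2)
proof (induction m)
  case 0
  have "odd_part 0 \<epsilon> = {||}" by (simp add: odd_part_def)
  moreover have "expo n (\<lambda>j. 0) = 0" by (simp add: expo_def)
  ultimately show ?case by (simp add: trailing_one)
next
  case (Suc m)
  let ?P = "prod_list (map (\<lambda>s. mui_M n (s - 1) ^ \<epsilon> s) [1..<m + 1]) :: 'p cohom"
  let ?g = "\<lambda>j. \<Sum>s = 1..m. \<epsilon> s * (if j = s then 0 else CARD('p) ^ (j - 1))"
  let ?h = "\<lambda>j. if j = m + 1 then 0 else CARD('p) ^ (j - 1)"
  have P: "prod_list (map (\<lambda>s. mui_M n (s - 1) ^ \<epsilon> s) [1..<Suc m + 1]) = ?P * mui_M n m ^ \<epsilon> (Suc m)"
    by simp
  have IH: "trailing ?P (odd_part m \<epsilon>) (expo n ?g)" using Suc by simp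
  from assms(1)[of "Suc m"] Suc.prems consider "\<epsilon> (Suc m) = 0" | "\<epsilon> (Suc m) = 1" by auto
  then show ?case
  proof cases
    case 1
    then have "odd_part (Suc m) \<epsilon> = odd_part m \<epsilon>"
      by (auto simp: odd_part_iff le_Suc_eq)
    then show ?thesis unfolding P using IH 1 by simp
  next
    case 2
    then have odd: "odd_part (Suc m) \<epsilon> = odd_part m \<epsilon> |\<union>| {|m + 1|}"
      by (auto simp: odd_part_iff le_Suc_eq)
    have disj: "odd_part m \<epsilon> |\<inter>| {|m + 1|} = {||}" by (auto simp: odd_part_iff)
    have m: "m < n" using Suc.prems by simp
    have *: "trailing (?P * mui_M n m) (odd_part (Suc m) \<epsilon>) (expo n (\<lambda>j. ?g j + ?h j))"
      using trailing_mult[OF IH trailing_mui_M[OF m] disj] unfolding odd expo_add .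
    have "expo n (\<lambda>j. \<Sum>s = 1..Suc m. \<epsilon> s * (if j = s then 0 else CARD('p) ^ (j - 1)))
        = expo n (\<lambda>j. ?g j + ?h j)"
      by (rule expo_cong) (simp add: 2)
    with * show ?thesis unfolding P by (simp only: 2 power_one_right)
  qed
qed

lemma trailing_const_prod:
  fixes f :: "'b \<Rightarrow> 'p::prime_card mpoly"
  assumes "\<And>s. s \<in> S \<Longrightarrow> trailing (ext_const (f s)) {||} (expo n (g s))" and "finite S"
  shows "trailing (ext_const (\<Prod>s\<in>S. f s ^ k s)) {||} (expo n (\<lambda>j. \<Sum>s\<in>S. k s * g s j))"
  using assms(2,1)
proof (induction S rule: finite_induct)
  case empty
  then show ?case by (simp add: trailing_one expo_def)
next
  case (insert s S)
  have "trailing (ext_const (f s) ^ k s) {||} (expo n (\<lambda>j. k s * g s j))"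
    using trailing_power[OF insert.prems[of s], of "k s"] unfolding expo_power by simp
  from trailing_mult[OF this insert.IH] insert show ?case
    by (simp add: ext_const_mult ext_const_power expo_add)
qed

text \<open>Divided by \<open>p^(j-1)\<close>, the exponent of \<open>x_j\<close> is
  \<open>b - epsilon_j\<close> from the determinants, \<open>(p-2) b + (p-1) i_1\<close> from
  \<open>L_n\<close> and \<open>(p-1) (i_2 + ... + i_j)\<close> from the remaining Dickson
  invariants. The total is \<open>(p-1) (i_1 + ... + i_j + b) - epsilon_j\<close>.\<close>

lemma trailing_qpoly:
  assumes I: "I \<in> indices n k" and p: "3 \<le> CARD('p)" and n: "1 \<le> n"
  shows "trailing (qpoly n I :: 'p::prime_card cohom) (odd_part n (fst I)) (even_part CARD('p) n I)"
proof -
  let ?p = "CARD('p)"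
  obtain \<epsilon> i where I': "I = (\<epsilon>, i)" by (cases I)
  have \<epsilon>: "\<epsilon> s \<in> {0, 1}" if "1 \<le> s" "s \<le> n" for s
    using I that by (auto simp: I' indices_def)
  have i: "0 \<le> i s" if "s \<in> {2..n}" for s
    using I that by (auto simp: I' indices_def)
  define e where "e = nat (L_exp ?p n I)"
  have e: "int e = int (?p - 2) * int (b_sum n \<epsilon>) + int (?p - 1) * i 1"
    using L_exp_nonneg[OF I p] by (simp add: e_def L_exp_def I')
  let ?g = "\<lambda>j. \<Sum>s = 1..n. \<epsilon> s * (if j = s then 0 else ?p ^ (j - 1))"
  let ?d = "\<lambda>j. \<Sum>s = 2..n. nat (i s) * (if j \<le> s - 1 then 0 else ?p ^ (j - 1) * (?p - 1))"
  have "trailing (qpoly n I :: 'p cohom) (odd_part n \<epsilon> |\<union>| ({||} |\<union>| {||}))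
      (expo n ?g + (expo n (\<lambda>j. e * ?p ^ (j - 1)) + expo n ?d))"
    unfolding qpoly_def qscal_def ext_const_mult I' fst_conv snd_conv
  proof (intro trailing_mult)
    show "trailing (prod_list (map (\<lambda>s. mui_M n (s - 1) ^ \<epsilon> s) [1..<n + 1]) :: 'p cohom)
      (odd_part n \<epsilon>) (expo n ?g)"
      by (rule trailing_M_prod[OF \<epsilon> order.refl])
    show "trailing (ext_const (L_poly n ^ nat (L_exp ?p n (\<epsilon>, i))) :: 'p cohom) {||} (expo n (\<lambda>j. e * ?p ^ (j - 1)))"
      using trailing_power[OF trailing_L_poly, where m = e] unfolding expo_power ext_const_power e_def I' .
    show "trailing (ext_const (\<Prod>s = 2..n. dickson_poly n (s - 1) ^ nat (i s)) :: 'p cohom) {||} (expo n ?d)"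
      by (rule trailing_const_prod, rule trailing_dickson_poly) auto
  qed auto
  moreover have "expo n ?g + (expo n (\<lambda>j. e * ?p ^ (j - 1)) + expo n ?d) = even_part ?p n I"
    unfolding expo_add even_part_def I' split_conv
  proof (rule expo_cong)
    fix j assume j: "1 \<le> j" "j \<le> n"
    let ?q = "int ?p ^ (j - 1)"
    have "int (?g j) = (\<Sum>s = 1..n. ?q * int (\<epsilon> s) - (if s = j then ?q * int (\<epsilon> j) else 0))"
      unfolding of_nat_sum by (intro sum.cong refl) auto
    also have "\<dots> = ?q * int (b_sum n \<epsilon>) - ?q * int (\<epsilon> j)"
      using j by (simp add: sum_subtractf b_sum_def sum_distrib_left)
    finally have g: "int (?g j) = ?q * int (b_sum n \<epsilon>) - ?q * int (\<epsilon> j)" .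
    have "int (?d j) = (\<Sum>s = 2..n. if s \<in> {2..j} then ?q * (int ?p - 1) * i s else 0)"
      unfolding of_nat_sum using i p by (intro sum.cong refl) (auto simp: of_nat_diff)
    also have "\<dots> = (\<Sum>s \<in> {2..n} \<inter> {2..j}. ?q * (int ?p - 1) * i s)"
      by (rule sum.inter_restrict[symmetric]) simp
    also have "{2..n} \<inter> {2..j} = {2..j}" using j by auto
    finally have d: "int (?d j) = ?q * (int ?p - 1) * (\<Sum>s = 2..j. i s)"
      by (simp add: sum_distrib_left)
    have s1: "(\<Sum>s = 1..j. i s) = i 1 + (\<Sum>s = 2..j. i s)"
      using j by (simp add: sum.atLeast_Suc_atMost numeral_2_eq_2)
    have "int (?g j + (e * ?p ^ (j - 1) + ?d j))
        = ?q * (int ?p - 1) * ((\<Sum>s = 1..j. i s) + int (b_sum n \<epsilon>)) - ?q * int (\<epsilon> j)"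
      unfolding of_nat_add g d of_nat_mult e s1 of_nat_power
      using p by (simp add: of_nat_diff algebra_simps)
    from arg_cong[OF this, of nat]
    show "?g j + (e * ?p ^ (j - 1) + ?d j)
      = nat (?q * (int ?p - 1) * ((\<Sum>s = 1..j. i s) + int (b_sum n \<epsilon>)) - ?q * int (\<epsilon> j))"
      unfolding nat_int .
  qed
  ultimately show ?thesis by (simp add: I')
qed

text \<open>From \<open>2 i_1 + b >= 0\<close> follows \<open>b <= 2 (i_1 + ... + i_j + b)\<close>,
  and \<open>epsilon_j <= b\<close> while \<open>2 <= p - 1\<close>. Hence \<open>nat\<close> loses
  no information when exponents are compared.\<close>

lemma even_part_nonneg:
  assumes I: "(\<epsilon>, i) \<in> indices n k" and p: "3 \<le> p" and j: "1 \<le> j" "j \<le> n"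
  shows "0 \<le> int p ^ (j - 1) * (int p - 1) * ((\<Sum>s = 1..j. i s) + int (b_sum n \<epsilon>)) - int p ^ (j - 1) * int (\<epsilon> j)"
proof -
  let ?b = "int (b_sum n \<epsilon>)"
  have i: "0 \<le> i s" if "s \<in> {2..j}" for s using I that j by (auto simp: indices_def)
  have "0 \<le> (\<Sum>s = 2..j. i s)" by (rule sum_nonneg) (rule i)
  moreover have "(\<Sum>s = 1..j. i s) = i 1 + (\<Sum>s = 2..j. i s)"
    using j by (simp add: sum.atLeast_Suc_atMost numeral_2_eq_2)
  moreover have "0 \<le> 2 * i 1 + ?b" using I by (auto simp: indices_def)
  ultimately have "?b \<le> 2 * ((\<Sum>s = 1..j. i s) + ?b)"
    unfolding distrib_left by linarith
  moreover have "2 * ((\<Sum>s = 1..j. i s) + ?b) \<le> (int p - 1) * ((\<Sum>s = 1..j. i s) + ?b)"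
    using p calculation by (intro mult_right_mono) auto
  moreover have "\<epsilon> j \<le> b_sum n \<epsilon>"
    unfolding b_sum_def using j by (intro member_le_sum) auto
  ultimately have "0 \<le> (int p - 1) * ((\<Sum>s = 1..j. i s) + ?b) - int (\<epsilon> j)" by linarith
  then have "0 \<le> int p ^ (j - 1) * ((int p - 1) * ((\<Sum>s = 1..j. i s) + ?b) - int (\<epsilon> j))" by simp
  also have "int p ^ (j - 1) * ((int p - 1) * ((\<Sum>s = 1..j. i s) + ?b) - int (\<epsilon> j))
      = int p ^ (j - 1) * (int p - 1) * ((\<Sum>s = 1..j. i s) + ?b) - int p ^ (j - 1) * int (\<epsilon> j)"
    by (simp add: algebra_simps)
  finally show ?thesis .
qed

text \<open>The exterior part determines the \<open>epsilon_s\<close>; the exponents then determine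
  all partial sums of the \<open>i_s\<close>, and consecutive differences give the
  \<open>i_s\<close> themselves.\<close>

lemma monomial_inj:
  assumes I: "I \<in> indices n k" and J: "J \<in> indices n k" and p: "3 \<le> p"
    and odd: "odd_part n (fst I) = odd_part n (fst J)" and even: "even_part p n I = even_part p n J"
  shows "I = J"
proof -
  obtain \<epsilon> i \<delta> j where I': "I = (\<epsilon>, i)" and J': "J = (\<delta>, j)" by (cases I, cases J)
  have ext: "\<epsilon> \<in> {1..n} \<rightarrow>\<^sub>E {0, 1}" "\<delta> \<in> {1..n} \<rightarrow>\<^sub>E {0, 1}" "i \<in> extensional {1..n}" "j \<in> extensional {1..n}"
    using I J by (auto simp: I' J' indices_def)
  have "\<epsilon> = \<delta>"
  proof (rule PiE_ext[OF ext(1,2)])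
    fix s assume s: "s \<in> {1..n}"
    then have "\<epsilon> s = 1 \<longleftrightarrow> \<delta> s = 1"
      using odd odd_part_iff[of s n \<epsilon>] odd_part_iff[of s n \<delta>] by (simp add: I' J')
    moreover have "\<epsilon> s \<in> {0, 1}" "\<delta> s \<in> {0, 1}" using ext(1,2) s by auto
    ultimately show "\<epsilon> s = \<delta> s" by auto
  qed
  have sums: "(\<Sum>l = 1..s. i l) = (\<Sum>l = 1..s. j l)" if "s \<le> n" for s
  proof (cases "s = 0")
    case False
    with that have s: "1 \<le> s" "s \<le> n" by auto
    let ?T = "\<lambda>\<epsilon> i. int p ^ (s - 1) * (int p - 1) * ((\<Sum>l = 1..s. i l) + int (b_sum n \<epsilon>)) - int p ^ (s - 1) * int (\<epsilon> s)"
    have "nat (?T \<epsilon> i) = nat (?T \<delta> j)"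
      using arg_cong[OF even, of "\<lambda>t. Poly_Mapping.lookup t s"] s
      unfolding I' J' even_part_def split_conv lookup_expo by simp
    moreover have "0 \<le> ?T \<epsilon> i" "0 \<le> ?T \<delta> j"
      using even_part_nonneg[OF I[unfolded I'] p s] even_part_nonneg[OF J[unfolded J'] p s] .
    ultimately have "?T \<epsilon> i = ?T \<delta> j" by (simp only: eq_nat_nat_iff)
    then show ?thesis using p \<open>\<epsilon> = \<delta>\<close> by simp
  qed simp
  have "i = j"
  proof (rule extensionalityI[OF ext(3,4)])
    fix s assume "s \<in> {1..n}"
    then obtain m where m: "s = Suc m" "Suc m \<le> n" by (cases s) auto
    then show "i s = j s" using sums[of m] sums[of "Suc m"] by simp
  qed
  with \<open>\<epsilon> = \<delta>\<close> show ?thesis by (simp add: I' J')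
qed

section \<open>Homology monomials and the pairing\<close>

definition hmon :: "nat fset \<Rightarrow> (nat \<Rightarrow>\<^sub>0 nat) \<Rightarrow> 'p::prime_card homol" where
  "hmon A t = Ext (Poly_Mapping.single A (DPow (Poly_Mapping.single t 1)))"

text \<open>Pairing with a homology monomial extracts one coefficient, the form in which supports
  and trailing monomials apply.\<close>

lemma pairing_hmon: "pairing (hmon A t :: 'p::prime_card homol) y = cohom_coeff y A t"
proof -
  have "Poly_Mapping.single A (DPow (Poly_Mapping.single t (1::'p mod_ring))) \<noteq> 0"
    by (metis DPow_inverse UNIV_I dpow_coeffs_inject lookup_single_eq lookup_zero zero_dpow_def zero_neq_one)
  then have "Poly_Mapping.keys (ext_coeffs (hmon A t :: 'p homol)) = {A}"
    unfolding hmon_def Ext_inverse[OF UNIV_I] keys_single by (auto split: if_splits)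
  moreover have "ext_coeff (hmon A t :: 'p homol) A = DPow (Poly_Mapping.single t 1)"
    by (simp add: hmon_def ext_coeff_def)
  ultimately show ?thesis by (simp add: pairing_def)
qed

text \<open>Increasing indices leave no inversions, hence no sign; disjoint variables make every
  binomial coefficient equal to 1.\<close>

lemma hmon_mult:
  assumes "\<And>a b. a |\<in>| A \<Longrightarrow> b |\<in>| B \<Longrightarrow> a < b"
    and "Poly_Mapping.keys s \<inter> Poly_Mapping.keys t = {}"
  shows "hmon A s * hmon B t = (hmon (A |\<union>| B) (s + t) :: 'p::prime_card homol)"
proof -
  have "A |\<inter>| B = {||}" using assms(1) by fastforce
  moreover have "{(a, b). a |\<in>| A \<and> b |\<in>| B \<and> b < a} = {}" using assms(1) by fastforce
  ultimately have sign: "shuffle_sign A B = (1 :: 'p mod_ring dpow)"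
    by (simp only: shuffle_sign_def card.empty power_0 if_True simp_thms)
  have "multi_choose s t = 1"
    unfolding multi_choose_def
  proof (rule prod.neutral, rule ballI)
    fix i
    have "Poly_Mapping.lookup s i = 0 \<or> Poly_Mapping.lookup t i = 0"
      using assms(2) by (auto simp: in_keys_iff)
    then show "(Poly_Mapping.lookup s i + Poly_Mapping.lookup t i) choose Poly_Mapping.lookup s i = 1" by auto
  qed
  then have "DPow (Poly_Mapping.single s 1) * DPow (Poly_Mapping.single t 1)
      = (DPow (Poly_Mapping.single (s + t) 1) :: 'p mod_ring dpow)"
    by (simp add: times_dpow_def conv_single)
  then show ?thesis
    by (simp add: hmon_def times_ext_def conv_single sign)
qed

lemma hmon_gen:
  assumes "e \<in> {0, 1}"
  shows "ext_gen s ^ e * ext_const (dpow_gen s m)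
    = (hmon (if e = 1 then {|s|} else {||}) (Poly_Mapping.single s m) :: 'p::prime_card homol)"
proof (cases "e = 0")
  case True
  then show ?thesis by (simp add: ext_const_def hmon_def dpow_gen_def)
next
  case False
  then have "e = 1" using assms by simp
  moreover have "shuffle_sign {|s|} {||} = (1 :: 'p mod_ring dpow)" by (simp add: shuffle_sign_def)
  ultimately show ?thesis
    unfolding \<open>e = 1\<close> power_one_right
    by (simp add: ext_gen_def ext_const_def hmon_def times_ext_def conv_single dpow_gen_def)
qed

lemma hmon_prod:
  assumes "\<And>s. 1 \<le> s \<Longrightarrow> s \<le> m \<Longrightarrow> \<epsilon> s \<in> {0, 1}"
  shows "prod_list (map (\<lambda>s. ext_gen s ^ \<epsilon> s * ext_const (dpow_gen s (f s))) [1..<m + 1])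
    = (hmon (odd_part m \<epsilon>) (expo m f) :: 'p::prime_card homol)"
  using assms
proof (induction m)
  case 0
  have "odd_part 0 \<epsilon> = {||}" by (simp add: odd_part_def)
  then show ?case by (simp add: hmon_def expo_def one_ext_def one_dpow_def)
next
  case (Suc m)
  let ?B = "if \<epsilon> (Suc m) = 1 then {|Suc m|} else {||}"
  have odd: "odd_part (Suc m) \<epsilon> = odd_part m \<epsilon> |\<union>| ?B"
    by (auto simp: odd_part_iff le_Suc_eq)
  have expo: "expo (Suc m) f = expo m f + Poly_Mapping.single (Suc m) (f (Suc m))"
    by (simp add: expo_def)
  have "hmon (odd_part m \<epsilon>) (expo m f) * hmon ?B (Poly_Mapping.single (Suc m) (f (Suc m)))
      = (hmon (odd_part (Suc m) \<epsilon>) (expo (Suc m) f) :: 'p homol)"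
    unfolding odd expo
  proof (rule hmon_mult)
    show "Poly_Mapping.keys (expo m f) \<inter> Poly_Mapping.keys (Poly_Mapping.single (Suc m) (f (Suc m))) = {}"
      using keys_expo[of m f] by (auto split: if_splits)
  qed (auto simp: odd_part_iff split: if_splits)
  moreover have "prod_list (map (\<lambda>s. ext_gen s ^ \<epsilon> s * ext_const (dpow_gen s (f s))) [1..<Suc m + 1])
     = prod_list (map (\<lambda>s. ext_gen s ^ \<epsilon> s * ext_const (dpow_gen s (f s))) [1..<m + 1])
       * (ext_gen (Suc m) ^ \<epsilon> (Suc m) * ext_const (dpow_gen (Suc m) (f (Suc m))) :: 'p homol)"
    by (simp add: mult.assoc)
  ultimately show ?case using Suc by (simp add: hmon_gen del: upt_Suc)
qed

lemma hom_mon_eq: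
  assumes "I \<in> indices n k"
  shows "hom_mon n I = (hmon (odd_part n (fst I)) (even_part CARD('p) n I) :: 'p::prime_card homol)"
proof -
  obtain \<epsilon> i where I: "I = (\<epsilon>, i)" by (cases I)
  have \<epsilon>: "\<epsilon> s \<in> {0, 1}" if "1 \<le> s" "s \<le> n" for s
    using assms that by (auto simp: I indices_def)
  show ?thesis
    unfolding I hom_mon_def even_part_def split_conv Let_def fst_conv by (rule hmon_prod[OF \<epsilon>])
qed

section \<open>Triangularity\<close>

text \<open>The unknown with the smallest key occurs in its own equation only. The other equations
  are solved first, and that one is then adjusted by dividing by the diagonal entry.\<close>

lemma triangular_system_solvable:
  fixes a :: "'i \<Rightarrow> 'i \<Rightarrow> 'c::field" and key :: "'i \<Rightarrow> 'o::linorder"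
  assumes "finite F" "inj_on key F" "\<And>I. I \<in> F \<Longrightarrow> a I I \<noteq> 0"
    and "\<And>I J. I \<in> F \<Longrightarrow> J \<in> F \<Longrightarrow> key J < key I \<Longrightarrow> a J I = 0"
  shows "\<exists>c. \<forall>I\<in>F. (\<Sum>J\<in>F. c J * a J I) = g I"
  using assms
proof (induction F rule: finite_psubset_induct)
  case (psubset F)
  show ?case
  proof (cases "F = {}")
    case False
    have "Min (key ` F) \<in> key ` F" using False psubset.hyps by (intro Min_in) auto
    then obtain K where K: "K \<in> F" "key K = Min (key ` F)" by auto
    have min: "key K < key I" if "I \<in> F - {K}" for I
    proof -
      have "key K \<le> key I" using that K(2) psubset.hyps by simp
      moreover have "key K \<noteq> key I" using that K(1) inj_onD[OF psubset.prems(1)] by blast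
      ultimately show ?thesis by simp
    qed
    have "\<exists>c. \<forall>I\<in>F - {K}. (\<Sum>J\<in>F - {K}. c J * a J I) = g I"
    proof (rule psubset.IH)
      show "inj_on key (F - {K})" by (rule inj_on_subset[OF psubset.prems(1)]) auto
    qed (use K psubset.prems in auto)
    then obtain c where c: "\<And>I. I \<in> F - {K} \<Longrightarrow> (\<Sum>J\<in>F - {K}. c J * a J I) = g I" by blast
    define c' where "c' = c(K := (g K - (\<Sum>J\<in>F - {K}. c J * a J K)) / a K K)"
    have split: "(\<Sum>J\<in>F. c' J * a J I) = c' K * a K I + (\<Sum>J\<in>F - {K}. c J * a J I)" for I
      unfolding sum.remove[OF psubset.hyps K(1)] by (simp add: c'_def)
    have "(\<Sum>J\<in>F. c' J * a J I) = g I" if "I \<in> F" for I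
    proof (cases "I = K")
      case True
      then show ?thesis unfolding split using psubset.prems(2)[OF K(1)] by (simp add: c'_def)
    next
      case False
      then have "I \<in> F - {K}" using that by simp
      then show ?thesis unfolding split using c psubset.prems(3)[OF that K(1) min] by simp
    qed
    then show ?thesis by blast
  qed simp
qed

lemma cohom_coeff_scale: "cohom_coeff (cohom_scale c y :: 'p::prime_card cohom) A t = c * cohom_coeff y A t"
proof -
  have 1: "Poly_Mapping.lookup (conv (|\<union>|) shuffle_sign (Poly_Mapping.single {||} u) f) A
      = u * Poly_Mapping.lookup f A" for u :: "'p mpoly" and f
    by (induction f rule: poly_mapping_induct_single)
      (simp_all add: conv_single conv_add_right shuffle_sign_def lookup_add distrib_left lookup_single when_def)
  have 2: "Poly_Mapping.lookup (Poly_Mapping.single 0 c * f) t = c * Poly_Mapping.lookup f t" for f :: "'p mpoly"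
    by (induction f rule: poly_mapping_induct_single)
      (simp_all add: mult_single lookup_single when_def distrib_left lookup_add)
  show ?thesis
    by (simp add: cohom_coeff_def cohom_scale_def ext_const_def ext_coeff_def times_ext_def 1 2)
qed

definition mon_degree :: "nat \<Rightarrow> nat \<Rightarrow> index \<Rightarrow> nat" where
  "mon_degree p n I = fcard (odd_part n (fst I)) + 2 * tdeg (even_part p n I)"

text \<open>As \<open>i_1\<close> may be negative, a bound on the indices is not evident. Instead,
  indices inject into monomials in \<open>n\<close> variables, of which only finitely many have
  bounded degree.\<close>

lemma finite_bounded_degree:
  assumes "3 \<le> p"
  shows "finite {I \<in> indices n k. mon_degree p n I \<le> D}"
proof -
  let ?F = "{I \<in> indices n k. mon_degree p n I \<le> D}"
  let ?f = "\<lambda>I. (fset (odd_part n (fst I)), Poly_Mapping.lookup (even_part p n I))"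
  let ?B = "Pow {1..n} \<times> {f. \<forall>x. (x \<in> {1..n} \<longrightarrow> f x \<in> {0..D}) \<and> (x \<notin> {1..n} \<longrightarrow> f x = 0)}"
  have "inj_on ?f ?F"
    using monomial_inj[OF _ _ assms]
    by (auto intro!: inj_onI simp: fset_inject lookup_inject)
  moreover have "?f ` ?F \<subseteq> ?B"
  proof (rule image_subsetI)
    fix I assume I: "I \<in> ?F"
    let ?t = "even_part p n I"
    have keys: "Poly_Mapping.keys ?t \<subseteq> {1..n}"
      unfolding even_part_def case_prod_beta by (rule keys_expo)
    have "Poly_Mapping.lookup ?t x \<le> D" if "x \<in> {1..n}" for x
    proof -
      have "Poly_Mapping.lookup ?t x \<le> tdeg ?t"
        unfolding tdeg_superset[OF finite_atLeastAtMost keys] using that by (intro member_le_sum) auto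
      then show ?thesis using I by (simp add: mon_degree_def)
    qed
    moreover have "fset (odd_part n (fst I)) \<subseteq> {1..n}" by (auto simp: odd_part_iff)
    ultimately show "?f I \<in> ?B" using keys by (auto simp: in_keys_iff)
  qed
  moreover have "finite ?B"
    by (intro finite_cartesian_product finite_set_of_finite_funs) auto
  ultimately show ?thesis by (meson finite_imageD finite_subset)
qed

lemma sum_pointwise: "(\<Sum>i\<in>S. f i) x = (\<Sum>i\<in>S. f i x :: 'a::comm_monoid_add)"
  by (induction S rule: infinite_finite_induct) simp_all

theorem theorem3p6:
  fixes n k :: nat
  assumes "odd CARD('p::prime_card)" and "1 \<le> n"
  shows "let elt = (\<lambda>I. dual_class k n (hom_mon n I) :: 'p cohom \<Rightarrow> 'p mod_ring) in
    inj_on elt (indices n k) \<and>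
    \<not> module.dependent dual_scale (elt ` indices n k) \<and>
    module.span dual_scale (elt ` indices n k) = BB_dual k n"
proof -
  interpret V: vector_space "cohom_scale :: 'p mod_ring \<Rightarrow> 'p cohom \<Rightarrow> 'p cohom"
    by (rule vector_space_cohom_scale)
  interpret D: vector_space "dual_scale :: 'p mod_ring \<Rightarrow> ('p cohom \<Rightarrow> 'p mod_ring) \<Rightarrow> _"
    by (rule vector_space_dual_scale)
  let ?p = "CARD('p)"
  let ?S = "indices n k"
  let ?B = "BB k n :: 'p cohom set"
  have p: "3 \<le> ?p"
    using assms(1) prime_card_gt_1[where 'p = 'p] by presburger
  define elt where "elt I = (dual_class k n (hom_mon n I) :: 'p cohom \<Rightarrow> 'p mod_ring)" for I
  define q where "q I = (qmon n I :: 'p cohom)" for I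
  define key where "key I = wt ?p (odd_part n (fst I)) (even_part ?p n I)" for I
  \<comment> \<open>The pairing matrix: rows are classes, columns are the monomials
    \<open>q I\<close>.\<close>
  define a where "a J I = cohom_coeff (q I) (odd_part n (fst J)) (even_part ?p n J)" for J I
  have B: "?B = V.span (q ` ?S)" by (simp add: BB_def q_def[abs_def])
  have qB: "q I \<in> ?B" if "I \<in> ?S" for I unfolding B using that by (intro V.span_base) auto
  have elt: "elt J y = (if y \<in> ?B then cohom_coeff y (odd_part n (fst J)) (even_part ?p n J) else 0)"
    if "J \<in> ?S" for J y
    using that by (simp add: elt_def dual_class_def hom_mon_eq pairing_hmon)
  have elt_q: "elt J (q I) = a J I" if "I \<in> ?S" "J \<in> ?S" for I J
    using that qB by (simp add: elt a_def)
  have trail: "trailing (q I) (odd_part n (fst I)) (even_part ?p n I)" if "I \<in> ?S" for I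
    unfolding q_def qmon_eq_qpoly[OF that p assms(2)] by (rule trailing_qpoly[OF that p assms(2)])
  have diag: "a I I \<noteq> 0" if "I \<in> ?S" for I
    using trailing_supp[OF trail[OF that]] by (simp add: a_def supp_def)
  have tri: "a J I = 0" if "I \<in> ?S" "J \<in> ?S" "I \<noteq> J" "\<not> key I < key J" for I J
  proof (rule ccontr)
    assume "a J I \<noteq> 0"
    then have "(odd_part n (fst J), even_part ?p n J) \<in> supp (q I)" by (simp add: a_def supp_def)
    moreover have "(odd_part n (fst J), even_part ?p n J) \<noteq> (odd_part n (fst I), even_part ?p n I)"
      using monomial_inj[OF that(2,1) p] that(3) by auto
    ultimately have "key I < key J" unfolding key_def using trailing_less[OF trail[OF that(1)]] by blast
    with that(4) show False ..
  qed
  have key_inj: "inj_on key ?S"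
  proof (rule inj_onI)
    fix I J assume IJ: "I \<in> ?S" "J \<in> ?S" "key I = key J"
    from wt_inject[OF IJ(3)[unfolded key_def]] show "I = J"
      using monomial_inj[OF IJ(1,2) p] by simp
  qed
  \<comment> \<open>Two equal classes would give nonzero entries on both sides of the diagonal, so
    each key would be below the other.\<close>
  have inj: "inj_on elt ?S"
  proof (rule inj_onI, rule ccontr)
    fix I J assume IJ: "I \<in> ?S" "J \<in> ?S" "elt I = elt J" "I \<noteq> J"
    have "a I I = a J I" "a I J = a J J"
      using IJ elt_q by metis+
    then have "key I < key J" "key J < key I"
      using IJ tri diag by metis+
    then show False by simp
  qed
  have indep: "\<not> D.dependent (elt ` ?S)"
  proof
    assume "D.dependent (elt ` ?S)"
    then obtain t u where t: "finite t" "t \<subseteq> elt ` ?S" "(\<Sum>v\<in>t. dual_scale (u v) v) = 0" "\<exists>v\<in>t. u v \<noteq> 0"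
      unfolding D.dependent_explicit by blast
    obtain T where T: "T \<subseteq> ?S" "finite T" "t = elt ` T"
      using finite_subset_image[OF t(1,2)] by blast
    \<comment> \<open>Evaluation at \<open>q I\<close> for the largest key of the relation isolates
      one term: a nonzero entry needs a key above \<open>key I\<close>, and such classes have
      coefficient zero.\<close>
    let ?T = "{J \<in> T. u (elt J) \<noteq> 0}"
    have "finite (key ` ?T)" "key ` ?T \<noteq> {}" using T t(4) by auto
    then have "Max (key ` ?T) \<in> key ` ?T" by (rule Max_in)
    then obtain I where I: "I \<in> T" "u (elt I) \<noteq> 0" "key I = Max (key ` ?T)" by auto
    have max: "\<not> key I < key J" if "J \<in> T" "u (elt J) \<noteq> 0" for J
      unfolding I(3) not_less using that T(2) by (intro Max_ge) auto
    have "(\<Sum>v\<in>t. dual_scale (u v) v) (q I) = (\<Sum>J\<in>T. u (elt J) * elt J (q I))"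
      unfolding T(3) sum.reindex[OF inj_on_subset[OF inj T(1)]] by (simp add: sum_pointwise dual_scale_def)
    also have "\<dots> = (\<Sum>J\<in>T. if J = I then u (elt I) * a I I else 0)"
    proof (intro sum.cong refl)
      fix J assume J: "J \<in> T"
      have IJ: "I \<in> ?S" "J \<in> ?S" using I(1) J T(1) by auto
      have "u (elt J) * a J I = (if J = I then u (elt I) * a I I else 0)"
        using tri[OF IJ] max[OF J] by (cases "u (elt J) = 0") auto
      then show "u (elt J) * elt J (q I) = (if J = I then u (elt I) * a I I else 0)"
        using elt_q[OF IJ] by simp
    qed
    also have "\<dots> = u (elt I) * a I I" using I(1) T(2) by simp
    finally show False using t(3) I(1,2) diag[of I] T(1) by auto
  qed
  have deg: "homogeneous (mon_degree ?p n I) (q I)" if I: "I \<in> ?S" for I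
  proof -
    obtain d where d: "homogeneous d (q I)"
      using homog_qpoly[of n I, where 'p = 'p] qmon_eq_qpoly[OF I p assms(2)] by (auto simp: homog_iff q_def)
    then have "mon_degree ?p n I = d"
      using diag[OF I] by (simp add: homogeneous_def a_def mon_degree_def tdeg_def)
    with d show ?thesis by simp
  qed
  have elt_dual: "elt I \<in> BB_dual k n" if I: "I \<in> ?S" for I
  proof -
    have "elt I y = 0" if "mon_degree ?p n I < d" "homogeneous d y" for d y
      using that by (auto simp: elt[OF I] homogeneous_def mon_degree_def tdeg_def)
    then have "\<exists>d. \<forall>c>d. \<forall>y\<in>?B. homogeneous c y \<longrightarrow> elt I y = 0" by blast
    moreover have "elt I (y + z) = elt I y + elt I z" if "y \<in> ?B" "z \<in> ?B" for y z
      using that V.span_add[of y "q ` ?S" z] by (simp add: elt[OF I] B)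
    moreover have "elt I (cohom_scale c y) = c * elt I y" if "y \<in> ?B" for c y
      using that V.span_scale[of y "q ` ?S" c] by (simp add: elt[OF I] B cohom_coeff_scale)
    moreover have "elt I y = 0" if "y \<notin> ?B" for y
      using that by (simp add: elt[OF I])
    ultimately show ?thesis unfolding BB_dual_def by blast
  qed
  have sub: "D.subspace (BB_dual k n)"
  proof (rule D.subspaceI)
    show "0 \<in> BB_dual k n" by (simp add: BB_dual_def)
  next
    fix \<phi> \<psi> :: "'p cohom \<Rightarrow> 'p mod_ring" assume \<phi>: "\<phi> \<in> BB_dual k n" and \<psi>: "\<psi> \<in> BB_dual k n"
    obtain d e where d: "\<forall>c>d. \<forall>y\<in>?B. homogeneous c y \<longrightarrow> \<phi> y = 0"
      and e: "\<forall>c>e. \<forall>y\<in>?B. homogeneous c y \<longrightarrow> \<psi> y = 0"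
      using \<phi> \<psi> unfolding BB_dual_def by blast
    have "(\<phi> + \<psi>) y = 0" if "max d e < c" "y \<in> ?B" "homogeneous c y" for c y
    proof -
      have "\<phi> y = 0" "\<psi> y = 0" using d e that by auto
      then show ?thesis by simp
    qed
    then have ex: "\<exists>d. \<forall>c>d. \<forall>y\<in>?B. homogeneous c y \<longrightarrow> (\<phi> + \<psi>) y = 0" by blast
    show "\<phi> + \<psi> \<in> BB_dual k n"
      using \<phi> \<psi> ex by (simp add: BB_dual_def distrib_left)
  next
    fix c :: "'p mod_ring" and \<phi> :: "'p cohom \<Rightarrow> 'p mod_ring" assume \<phi>: "\<phi> \<in> BB_dual k n"
    then have ex: "\<exists>d. \<forall>b>d. \<forall>y\<in>?B. homogeneous b y \<longrightarrow> c = 0 \<or> \<phi> y = 0"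
      unfolding BB_dual_def by blast
    show "dual_scale c \<phi> \<in> BB_dual k n"
      using \<phi> ex by (simp add: BB_dual_def dual_scale_def distrib_left mult.left_commute)
  qed
  have "\<phi> \<in> D.span (elt ` ?S)" if \<phi>: "\<phi> \<in> BB_dual k n" for \<phi>
  proof -
    obtain d where d: "\<And>c y. d < c \<Longrightarrow> y \<in> ?B \<Longrightarrow> homogeneous c y \<Longrightarrow> \<phi> y = 0"
      using \<phi> unfolding BB_dual_def by blast
    \<comment> \<open>Beyond degree \<open>d\<close> the functional vanishes, so only finitely many
      equations remain to be solved.\<close>
    define F where "F = {I \<in> ?S. mon_degree ?p n I \<le> d}"
    have F: "finite F" "F \<subseteq> ?S" using finite_bounded_degree[OF p] by (auto simp: F_def)
    have "\<exists>c. \<forall>I\<in>F. (\<Sum>J\<in>F. c J * a J I) = \<phi> (q I)"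
    proof (rule triangular_system_solvable[where key = key])
      show "inj_on key F" by (rule inj_on_subset[OF key_inj F(2)])
      show "a J I = 0" if "I \<in> F" "J \<in> F" "key J < key I" for I J
        using that F(2) by (intro tri) auto
    qed (use F diag in auto)
    then obtain c where c: "\<And>I. I \<in> F \<Longrightarrow> (\<Sum>J\<in>F. c J * a J I) = \<phi> (q I)" by blast
    define \<psi> where "\<psi> = (\<Sum>J\<in>F. dual_scale (c J) (elt J))"
    have \<psi>_span: "\<psi> \<in> D.span (elt ` ?S)"
      unfolding \<psi>_def using F(2) by (intro D.span_sum D.span_scale D.span_base) auto
    have \<psi>: "\<psi> \<in> BB_dual k n"
      unfolding \<psi>_def using F(2) elt_dual by (intro D.subspace_sum[OF sub] D.subspace_scale[OF sub]) auto
    have agree: "\<phi> (q I) = \<psi> (q I)" if I: "I \<in> ?S" for I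
    proof -
      have \<psi>q: "\<psi> (q I) = (\<Sum>J\<in>F. c J * a J I)"
        unfolding \<psi>_def sum_pointwise dual_scale_def
        using F(2) elt_q[OF I] by (intro sum.cong) auto
      show ?thesis
      proof (cases "I \<in> F")
        case False
        then have "d < mon_degree ?p n I" using I by (simp add: F_def)
        \<comment> \<open>A class sees a single degree, and those in \<open>F\<close> have degree at
          most \<open>d\<close>.\<close>
        moreover have "a J I = 0" if "J \<in> F" for J
        proof (rule ccontr)
          assume "a J I \<noteq> 0"
          then have "mon_degree ?p n J = mon_degree ?p n I"
            using deg[OF I] by (simp add: homogeneous_def a_def mon_degree_def tdeg_def)
          then show False using that \<open>d < mon_degree ?p n I\<close> by (simp add: F_def)
        qed
        ultimately show ?thesis using d[OF _ qB[OF I] deg[OF I]] \<psi>q by simp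
      qed (use c \<psi>q in simp)
    qed
    have "\<phi> y = \<psi> y" for y
    proof (cases "y \<in> ?B")
      case False
      then show ?thesis using \<phi> \<psi> by (simp add: BB_dual_def)
    next
      case True
      have lin: "\<chi> 0 = 0" "y \<in> ?B \<Longrightarrow> z \<in> ?B \<Longrightarrow> \<chi> (y + z) = \<chi> y + \<chi> z"
        "y \<in> ?B \<Longrightarrow> \<chi> (cohom_scale r y) = r * \<chi> y" if "\<chi> \<in> BB_dual k n" for \<chi> y z r
      proof -
        show scale: "\<chi> (cohom_scale r y) = r * \<chi> y" if "y \<in> ?B" for y r
          using that \<open>\<chi> \<in> BB_dual k n\<close> by (simp add: BB_dual_def)
        show "\<chi> 0 = 0" using scale[of 0 0] V.span_zero by (simp add: B)
        show "\<chi> (y + z) = \<chi> y + \<chi> z" if "y \<in> ?B" "z \<in> ?B"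
          using that \<open>\<chi> \<in> BB_dual k n\<close> by (simp add: BB_dual_def)
      qed
      have "y \<in> V.span (q ` ?S)" using True by (simp add: B)
      \<comment> \<open>Membership is carried through the induction because the functionals are
        additive only on \<open>BB k n\<close>.\<close>
      then have "y \<in> ?B \<and> \<phi> y = \<psi> y"
      proof (induction rule: V.span_induct_alt)
        case base
        then show ?case using lin(1)[OF \<phi>] lin(1)[OF \<psi>] by (simp add: B V.span_zero)
      next
        case (step r x z)
        then obtain I where I: "I \<in> ?S" "x = q I" by auto
        have "cohom_scale r x \<in> ?B" using qB[OF I(1)] I(2) by (simp add: B V.span_scale)
        then show ?case
          using step I qB[OF I(1)] agree[OF I(1)] lin(2,3)[OF \<phi>] lin(2,3)[OF \<psi>]
          by (simp add: B V.span_add)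
      qed
      then show ?thesis by simp
    qed
    then have "\<phi> = \<psi>" by auto
    then show ?thesis using \<psi>_span by simp
  qed
  then have "D.span (elt ` ?S) = BB_dual k n"
    using D.span_minimal[OF _ sub, of "elt ` ?S"] elt_dual by blast
  with inj indep show ?thesis by (simp add: Let_def elt_def[abs_def])
qed

end
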